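(* Let $A_q(G)$ be a Hopf algebra over a field of characteristic zero, let $(A_q(K),\pi_{GK})$ be a quantum subgroup of $A_q(G)$, coisotropic or not, and let $(A_q(H),\pi_{KH})$ be a coisotropic quantum subgroup of $A_q(K)$; regard $A_q(H)$ as a coisotropic quantum subgroup of $A_q(G)$ via $\pi_{GH}=\pi_{KH}\circ\pi_{GK}$. Let $\rho_R$ be a right corepresentation of $A_q(H)$ on a vector space $V$. Then there is an equivalence of right $A_q(G)$-corepresentations $$\mathrm{ind}_H^G(\rho_R)\equiv\mathrm{ind}_K^G\big(\mathrm{ind}_H^K(\rho_R)\big).$$ The same property holds for left corepresentations: if $\rho_L$ is a left corepresentation of $A_q(H)$, then $\mathrm{ind}_H^G(\rho_L)\equiv\mathrm{ind}_K^G(\mathrm{ind}_H^K(\rho_L))$ as left $A_q(G)$-corepresentations.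
   Context: All vector spaces are over a fixed field of characteristic zero. For a Hopf algebra $A$: a quantum subgroup of $A$ is a pair $(B,\pi)$ with $B$ a Hopf algebra and $\pi:A\to B$ a Hopf algebra epimorphism; a left (resp. right) coisotropic quantum subgroup of $A$ is a pair $(C,\pi)$ where $C$ is a coalgebra and a left (resp. right) $A$-module and $\pi:A\to C$ is a surjective linear map which is a coalgebra homomorphism and a left (resp. right) $A$-module homomorphism. When $A_q(K)$ is a (Hopf) quantum subgroup of $A_q(G)$, "coisotropic quantum subgroup of $A_q(K)$" is in this sense with $A=A_q(K)$. When $(A_q(K),\pi_{GK})$ is only a left (resp. right) coisotropic quantum subgroup of $A_q(G)$, "coisotropic quantum subgroup of $A_q(K)$" means a coalgebra $A_q(H)$ that is a left (resp. right) $A_q(G)$-module with a surjective linear map $\pi_{KH}:A_q(K)\to A_q(H)$ that is a coalgebra and left (resp. right) $A_q(G)$-module homomorphism. A right (resp. left) corepresentation of a coalgebra $C$ on $V$ is a counital coassociative linear map $V\to V\otimes C$ (resp. $V\to C\otimes V$). Two corepresentations are equivalent if there is a linear isomorphism between their spaces intertwining the coactions. Induction: for $(X,Y)\in\{(G,K),(K,H),(G,H)\}$ let $\Delta_X$ be the coproduct of $A_q(X)$, $L_{XY}=(\pi_{XY}\otimes\mathrm{id})\circ\Delta_X:A_q(X)\to A_q(Y)\otimes A_q(X)$ and $R_{XY}=(\mathrm{id}\otimes\pi_{XY})\circ\Delta_X:A_q(X)\to A_q(X)\otimes A_q(Y)$. For a right corepresentation $\rho_R$ of $A_q(Y)$ on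 $V$, $$\mathrm{ind}_Y^X(\rho_R)=\{F\in V\otimes A_q(X) : (\mathrm{id}\otimes L_{XY})(F)=(\rho_R\otimes\mathrm{id})(F)\},$$ a right corepresentation of $A_q(X)$ via $\mathrm{id}\otimes\Delta_X$. For a left corepresentation $\rho_L$ of $A_q(Y)$ on $V$, $$\mathrm{ind}_Y^X(\rho_L)=\{F\in A_q(X)\otimes V : (R_{XY}\otimes\mathrm{id})(F)=(\mathrm{id}\otimes\rho_L)(F)\},$$ a left corepresentation of $A_q(X)$ via $\Delta_X\otimes\mathrm{id}$. *)

theory Defs
  imports Complex_Main "HOL-Library.Function_Algebras"
begin

section \<open>Vector spaces and linear maps\<close>

text \<open>
  A vector space is given by a linear subspace of an ambient vector space which is a full type.
  Taking the whole type as carrier gives an arbitrary vector space; proper carriers are needed for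
  the representation spaces of induced corepresentations. Linear maps only matter on carriers.
\<close>

record ('k, 'v) vspace =
  vecs :: "'v set"
  scl :: "'k \<Rightarrow> 'v \<Rightarrow> 'v"

definition vec_space :: "('k::field, 'v::ab_group_add, 'z) vspace_scheme \<Rightarrow> bool" where
  "vec_space V \<longleftrightarrow> vector_space (scl V) \<and> module.subspace (scl V) (vecs V)"

definition ground :: "('k::field, 'k) vspace" where
  "ground = \<lparr>vecs = UNIV, scl = (*)\<rparr>"

definition lin :: "('k::field, 'v::ab_group_add, 'y) vspace_scheme \<Rightarrow>
    ('k, 'w::ab_group_add, 'z) vspace_scheme \<Rightarrow> ('v \<Rightarrow> 'w) \<Rightarrow> bool" where
  "lin V W f \<longleftrightarrow>
     (\<forall>x\<in>vecs V. f x \<in> vecs W) \<and>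
     (\<forall>x\<in>vecs V. \<forall>y\<in>vecs V. f (x + y) = f x + f y) \<and>
     (\<forall>c. \<forall>x\<in>vecs V. f (scl V c x) = scl W c (f x))"

definition bilin :: "('k::field, 'v::ab_group_add, 'x) vspace_scheme \<Rightarrow>
    ('k, 'w::ab_group_add, 'y) vspace_scheme \<Rightarrow> ('k, 'u::ab_group_add, 'z) vspace_scheme \<Rightarrow>
    ('v \<Rightarrow> 'w \<Rightarrow> 'u) \<Rightarrow> bool" where
  "bilin V W U b \<longleftrightarrow>
     (\<forall>w\<in>vecs W. lin V U (\<lambda>v. b v w)) \<and> (\<forall>v\<in>vecs V. lin W U (b v))"

section \<open>Tensor products\<close>

text \<open>
  The tensor product of two vector spaces is the span of the functionals
  \<open>v \<otimes> w = (\<lambda>b. b v w)\<close> in the dual of the space of bilinear forms. Forms are taken on the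
  ambient types and each functional is extended by zero to functions that are not bilinear. As
  every bilinear form on a product of subspaces extends, the tensor product of subspaces is thereby
  literally the corresponding subspace of the tensor product of the ambient spaces. The universal
  property, which fixes the construction up to unique isomorphism, is proved below.
\<close>

type_synonym ('v, 'w, 'k) tensor = "('v \<Rightarrow> 'w \<Rightarrow> 'k) \<Rightarrow> 'k"

definition bilinear_form :: "('k::field, 'v::ab_group_add, 'y) vspace_scheme \<Rightarrow>
    ('k, 'w::ab_group_add, 'z) vspace_scheme \<Rightarrow> ('v \<Rightarrow> 'w \<Rightarrow> 'k) \<Rightarrow> bool" where
  "bilinear_form V W b \<longleftrightarrow>
     (\<forall>w. Vector_Spaces.linear (scl V) (*) (\<lambda>v. b v w)) \<and>
     (\<forall>v. Vector_Spaces.linear (scl W) (*) (b v))"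

definition tens :: "('k::field, 'v::ab_group_add, 'y) vspace_scheme \<Rightarrow>
    ('k, 'w::ab_group_add, 'z) vspace_scheme \<Rightarrow> 'v \<Rightarrow> 'w \<Rightarrow> ('v, 'w, 'k) tensor" where
  "tens V W v w = (\<lambda>b. if bilinear_form V W b then b v w else 0)"

definition tscl :: "'k::field \<Rightarrow> ('v, 'w, 'k) tensor \<Rightarrow> ('v, 'w, 'k) tensor" where
  "tscl c t = (\<lambda>b. c * t b)"

definition tensor_space :: "('k::field, 'v::ab_group_add, 'y) vspace_scheme \<Rightarrow>
    ('k, 'w::ab_group_add, 'z) vspace_scheme \<Rightarrow> ('k, ('v, 'w, 'k) tensor) vspace"
    (infixr \<open>\<otimes>\<close> 75) where
  "V \<otimes> W = \<lparr>vecs = module.span tscl {tens V W v w | v w. v \<in> vecs V \<and> w \<in> vecs W}, scl = tscl\<rparr>"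

text \<open>
  The linear map on \<open>V \<otimes> W\<close> induced by a bilinear map; its values on \<open>V \<otimes> W\<close> are uniquely
  determined (see \<open>tlift_lin\<close>, \<open>tlift_tens\<close> and \<open>lin_tensor_unique\<close> below).
\<close>

definition tlift :: "('k::field, 'v::ab_group_add, 'x) vspace_scheme \<Rightarrow>
    ('k, 'w::ab_group_add, 'y) vspace_scheme \<Rightarrow> ('k, 'u::ab_group_add, 'z) vspace_scheme \<Rightarrow>
    ('v \<Rightarrow> 'w \<Rightarrow> 'u) \<Rightarrow> ('v, 'w, 'k) tensor \<Rightarrow> 'u" where
  "tlift V W U b = (SOME f. lin (V \<otimes> W) U f \<and>
     (\<forall>v\<in>vecs V. \<forall>w\<in>vecs W. f (tens V W v w) = b v w))"

lemma tscl_vector_space: "vector_space (tscl :: 'k::field \<Rightarrow> _)"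
  by unfold_locales (auto simp: tscl_def fun_eq_iff algebra_simps)

lemma vec_space_tensor:
  fixes V :: "('k::field, 'v::ab_group_add, 'x) vspace_scheme"
    and W :: "('k, 'w::ab_group_add, 'y) vspace_scheme"
  shows "vec_space (V \<otimes> W)"
proof -
  interpret t: vector_space "tscl :: 'k \<Rightarrow> ('v, 'w, 'k) tensor \<Rightarrow> _"
    by (rule tscl_vector_space)
  show ?thesis by (simp add: vec_space_def tensor_space_def tscl_vector_space)
qed

lemma tens_bilin:
  fixes V :: "('k::field, 'v::ab_group_add, 'x) vspace_scheme"
    and W :: "('k, 'w::ab_group_add, 'y) vspace_scheme"
  assumes "vec_space V" "vec_space W"
  shows "bilin V W (V \<otimes> W) (tens V W)"
proof -
  interpret t: vector_space "tscl :: 'k \<Rightarrow> ('v, 'w, 'k) tensor \<Rightarrow> _"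
    by (rule tscl_vector_space)
  have *: "tens V W v w \<in> vecs (V \<otimes> W)" if "v \<in> vecs V" "w \<in> vecs W" for v w
    using that by (auto simp: tensor_space_def intro!: t.span_base)
  have "tens V W (v + v') w = tens V W v w + tens V W v' w"
    "tens V W v (w + w') = tens V W v w + tens V W v w'"
    "tens V W (scl V c v) w = tscl c (tens V W v w)"
    "tens V W v (scl W c w) = tscl c (tens V W v w)" for v v' w w' c
    by (auto simp: tens_def tscl_def fun_eq_iff bilinear_form_def Vector_Spaces.linear_iff)
  moreover have "scl (V \<otimes> W) = tscl" by (simp add: tensor_space_def)
  ultimately show ?thesis by (simp add: bilin_def lin_def *)
qed

lemma lin_tensor_unique:
  fixes V :: "('k::field, 'v::ab_group_add, 'x) vspace_scheme"
    and W :: "('k, 'w::ab_group_add, 'y) vspace_scheme"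
    and U :: "('k, 'u::ab_group_add, 'z) vspace_scheme"
  assumes U: "vec_space U" and f: "lin (V \<otimes> W) U f" and g: "lin (V \<otimes> W) U g"
    and eq: "\<And>v w. v \<in> vecs V \<Longrightarrow> w \<in> vecs W \<Longrightarrow> f (tens V W v w) = g (tens V W v w)"
    and t: "t \<in> vecs (V \<otimes> W)"
  shows "f t = g t"
proof -
  interpret t: vector_space "tscl :: 'k \<Rightarrow> ('v, 'w, 'k) tensor \<Rightarrow> _"
    by (rule tscl_vector_space)
  interpret u: vector_space "scl U" using U by (simp add: vec_space_def)
  let ?S = "{tens V W v w | v w. v \<in> vecs V \<and> w \<in> vecs W}"
  have V: "vecs (V \<otimes> W) = t.span ?S" "scl (V \<otimes> W) = tscl"
    by (simp_all add: tensor_space_def)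
  have sub: "t.subspace {x \<in> t.span ?S. f x = g x}"
  proof (rule t.subspaceI)
    have "f (tscl 0 0) = scl U 0 (f 0)" "g (tscl 0 0) = scl U 0 (g 0)"
      using f g t.span_zero[of ?S] unfolding lin_def V by blast+
    then show "0 \<in> {x \<in> t.span ?S. f x = g x}"
      by (simp add: t.span_zero)
  qed (use f g in \<open>auto simp: lin_def V t.span_add t.span_scale\<close>)
  have "t.span ?S \<subseteq> {x \<in> t.span ?S. f x = g x}"
    by (rule t.span_minimal[OF _ sub]) (use eq t.span_base[of _ ?S] in blast)
  then show ?thesis using t V by auto
qed

lemma subspace_projection:
  assumes "vec_space V"
  obtains p where "Vector_Spaces.linear (scl V) (scl V) p" "range p \<subseteq> vecs V"
    "\<And>v. v \<in> vecs V \<Longrightarrow> p v = v"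
proof -
  interpret v: vector_space "scl V" using assms by (simp add: vec_space_def)
  interpret vv: vector_space_pair "scl V" "scl V" ..
  have "\<exists>p. range p \<subseteq> vecs V \<and> Vector_Spaces.linear (scl V) (scl V) p \<and> (\<forall>v\<in>vecs V. p (id v) = v)"
    by (rule vv.linear_exists_left_inverse_on)
      (use assms in \<open>auto simp: vec_space_def Vector_Spaces.linear_iff\<close>)
  then show ?thesis using that by auto
qed

lemma functional_separates:
  assumes "vector_space (s :: 'k::field \<Rightarrow> 'u::ab_group_add \<Rightarrow> 'u)"
    and eq: "\<And>l. Vector_Spaces.linear s (*) l \<Longrightarrow> l x = l y"
  shows "x = y"
proof (rule ccontr)
  assume ne: "x \<noteq> y"
  interpret u: vector_space s by fact
  interpret k: vector_space "(*) :: 'k \<Rightarrow> 'k \<Rightarrow> 'k"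
    by unfold_locales (auto simp: algebra_simps)
  interpret uk: vector_space_pair s "(*) :: 'k \<Rightarrow> 'k \<Rightarrow> 'k" ..
  have "u.independent {x - y}" using ne by simp
  from uk.linear_independent_extend[OF this, of "\<lambda>_. 1"]
  obtain l where l: "Vector_Spaces.linear s (*) l" "l (x - y) = 1" by auto
  then interpret l: Vector_Spaces.linear s "(*)" l by simp
  show False using eq[OF l(1)] l(2) by (simp add: l.diff)
qed

lemma tensor_universal:
  fixes V :: "('k::field, 'v::ab_group_add, 'x) vspace_scheme"
    and W :: "('k, 'w::ab_group_add, 'y) vspace_scheme"
    and U :: "('k, 'u::ab_group_add, 'z) vspace_scheme"
  assumes V: "vec_space V" and W: "vec_space W" and U: "vec_space U" and b: "bilin V W U b"
  shows "\<exists>f. lin (V \<otimes> W) U f \<and> (\<forall>v\<in>vecs V. \<forall>w\<in>vecs W. f (tens V W v w) = b v w)"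
proof -
  interpret t: vector_space "tscl :: 'k \<Rightarrow> ('v, 'w, 'k) tensor \<Rightarrow> _"
    by (rule tscl_vector_space)
  interpret u: vector_space "scl U" using U by (simp add: vec_space_def)
  interpret k: vector_space "(*) :: 'k \<Rightarrow> 'k \<Rightarrow> 'k"
    by unfold_locales (auto simp: algebra_simps)
  have subU: "u.subspace (vecs U)" using U by (simp add: vec_space_def)
  let ?S = "{tens V W v w | v w. v \<in> vecs V \<and> w \<in> vecs W}"
  have VW: "vecs (V \<otimes> W) = t.span ?S" "scl (V \<otimes> W) = tscl"
    by (simp_all add: tensor_space_def)
  obtain p where p: "Vector_Spaces.linear (scl V) (scl V) p" "range p \<subseteq> vecs V"
    "\<And>v. v \<in> vecs V \<Longrightarrow> p v = v" using subspace_projection[OF V] by blast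
  obtain q where q: "Vector_Spaces.linear (scl W) (scl W) q" "range q \<subseteq> vecs W"
    "\<And>w. w \<in> vecs W \<Longrightarrow> q w = w" using subspace_projection[OF W] by blast
  have pV: "p v \<in> vecs V" and qW: "q w \<in> vecs W" for v w using p(2) q(2) by auto
  define B where "B l = (\<lambda>v w. l (b (p v) (q w)) :: 'k)" for l
  have B: "bilinear_form V W (B l)" if "Vector_Spaces.linear (scl U) (*) l" for l
    using that p(1) q(1) b pV qW
    by (auto simp: bilinear_form_def B_def Vector_Spaces.linear_iff bilin_def lin_def)
  define R where "R t x \<longleftrightarrow> x \<in> vecs U \<and>
      (\<forall>l. Vector_Spaces.linear (scl U) (*) l \<longrightarrow> l x = t (B l))" for t x
  have R_unique: "x = y" if "R t x" "R t y" for t x y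
    using that by (intro functional_separates[OF u.vector_space_axioms]) (auto simp: R_def)
  have R_add: "R (s + t) (x + y)" if "R s x" "R t y" for s t x y
    using that u.subspace_add[OF subU] by (auto simp: R_def Vector_Spaces.linear_iff)
  have R_scl: "R (tscl c t) (scl U c x)" if "R t x" for c t x
    using that u.subspace_scale[OF subU] by (auto simp: R_def Vector_Spaces.linear_iff tscl_def)
  have R_tens: "R (tens V W v w) (b v w)" if "v \<in> vecs V" "w \<in> vecs W" for v w
    using that b B p(3) q(3) by (auto simp: R_def tens_def B_def bilin_def lin_def)
  have R0: "R 0 0"
    using u.subspace_0[OF subU] by (auto simp: R_def linear_iff_module_hom module_hom.zero)
  have "t.subspace {t. \<exists>x. R t x}"
    by (rule t.subspaceI) (use R_add R_scl R0 in blast)+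
  then have "t.span ?S \<subseteq> {t. \<exists>x. R t x}"
    by (rule t.span_minimal[rotated]) (use R_tens in blast)
  then have ex: "\<exists>x. R t x" if "t \<in> t.span ?S" for t using that by auto
  define f where "f t = (SOME x. R t x)" for t
  have fR: "R t (f t)" if "t \<in> t.span ?S" for t
    using ex[OF that] unfolding f_def by (rule someI_ex)
  have "lin (V \<otimes> W) U f"
    unfolding lin_def VW
  proof (intro conjI ballI allI)
    fix s assume s: "s \<in> t.span ?S"
    show "f s \<in> vecs U" using fR[OF s] by (simp add: R_def)
    show "f (tscl c s) = scl U c (f s)" for c
      by (rule R_unique[OF fR R_scl[OF fR]]) (use s in \<open>auto simp: t.span_scale\<close>)
    fix t assume t: "t \<in> t.span ?S"
    show "f (s + t) = f s + f t"
      by (rule R_unique[OF fR R_add[OF fR fR]]) (use s t in \<open>auto simp: t.span_add\<close>)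
  qed
  moreover have "f (tens V W v w) = b v w" if "v \<in> vecs V" "w \<in> vecs W" for v w
    by (rule R_unique[OF fR[OF t.span_base] R_tens[OF that]]) (use that in blast)
  ultimately show ?thesis by blast
qed

lemma
  assumes "vec_space V" "vec_space W" "vec_space U" "bilin V W U b"
  shows tlift_lin: "lin (V \<otimes> W) U (tlift V W U b)"
    and tlift_tens: "v \<in> vecs V \<Longrightarrow> w \<in> vecs W \<Longrightarrow> tlift V W U b (tens V W v w) = b v w"
  using someI_ex[OF tensor_universal[OF assms]] unfolding tlift_def by auto

text \<open>\<open>tmap V W V' W' f g\<close> is \<open>f \<otimes> g : V \<otimes> W \<rightarrow> V' \<otimes> W'\<close>.\<close>

definition tmap :: "('k::field, 'v::ab_group_add, 'x) vspace_scheme \<Rightarrow>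
    ('k, 'w::ab_group_add, 'y) vspace_scheme \<Rightarrow> ('k, 'v'::ab_group_add, 'z) vspace_scheme \<Rightarrow>
    ('k, 'w'::ab_group_add, 'u) vspace_scheme \<Rightarrow> ('v \<Rightarrow> 'v') \<Rightarrow> ('w \<Rightarrow> 'w') \<Rightarrow>
    ('v, 'w, 'k) tensor \<Rightarrow> ('v', 'w', 'k) tensor" where
  "tmap V W V' W' f g = tlift V W (V' \<otimes> W') (\<lambda>v w. tens V' W' (f v) (g w))"

text \<open>The canonical isomorphisms \<open>U \<otimes> (V \<otimes> W) \<rightarrow> (U \<otimes> V) \<otimes> W\<close> and back.\<close>

definition assoc_l :: "('k::field, 'u::ab_group_add, 'x) vspace_scheme \<Rightarrow>
    ('k, 'v::ab_group_add, 'y) vspace_scheme \<Rightarrow> ('k, 'w::ab_group_add, 'z) vspace_scheme \<Rightarrow>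
    ('u, ('v, 'w, 'k) tensor, 'k) tensor \<Rightarrow> (('u, 'v, 'k) tensor, 'w, 'k) tensor" where
  "assoc_l U V W = tlift U (V \<otimes> W) ((U \<otimes> V) \<otimes> W)
     (\<lambda>u. tlift V W ((U \<otimes> V) \<otimes> W) (\<lambda>v w. tens (U \<otimes> V) W (tens U V u v) w))"

definition assoc_r :: "('k::field, 'u::ab_group_add, 'x) vspace_scheme \<Rightarrow>
    ('k, 'v::ab_group_add, 'y) vspace_scheme \<Rightarrow> ('k, 'w::ab_group_add, 'z) vspace_scheme \<Rightarrow>
    (('u, 'v, 'k) tensor, 'w, 'k) tensor \<Rightarrow> ('u, ('v, 'w, 'k) tensor, 'k) tensor" where
  "assoc_r U V W = tlift (U \<otimes> V) W (U \<otimes> (V \<otimes> W))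
     (\<lambda>t w. tlift U V (U \<otimes> (V \<otimes> W)) (\<lambda>u v. tens U (V \<otimes> W) u (tens V W v w)) t)"

section \<open>Coalgebras and Hopf algebras\<close>

record ('k, 'a) coalg = "('k, 'a) vspace" +
  comult :: "'a \<Rightarrow> ('a, 'a, 'k) tensor"
  counit :: "'a \<Rightarrow> 'k"

definition coalgebra :: "('k::field, 'a::ab_group_add, 'z) coalg_scheme \<Rightarrow> bool" where
  "coalgebra C \<longleftrightarrow> vec_space C \<and> lin C (C \<otimes> C) (comult C) \<and> lin C ground (counit C) \<and>
     (\<forall>c\<in>vecs C.
        tmap C C (C \<otimes> C) C (comult C) id (comult C c) =
        assoc_l C C C (tmap C C C (C \<otimes> C) id (comult C) (comult C c))) \<and>
     (\<forall>c\<in>vecs C. tlift C C C (\<lambda>x y. scl C (counit C x) y) (comult C c) = c) \<and>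
     (\<forall>c\<in>vecs C. tlift C C C (\<lambda>x y. scl C (counit C y) x) (comult C c) = c)"

record ('k, 'a) hopf = "('k, 'a) coalg" +
  amult :: "'a \<Rightarrow> 'a \<Rightarrow> 'a"
  aunit :: 'a
  antipode :: "'a \<Rightarrow> 'a"

definition unital_algebra :: "('k::field, 'a::ab_group_add, 'z) hopf_scheme \<Rightarrow> bool" where
  "unital_algebra A \<longleftrightarrow> vec_space A \<and> bilin A A A (amult A) \<and> aunit A \<in> vecs A \<and>
     (\<forall>a\<in>vecs A. \<forall>b\<in>vecs A. \<forall>c\<in>vecs A. amult A (amult A a b) c = amult A a (amult A b c)) \<and>
     (\<forall>a\<in>vecs A. amult A (aunit A) a = a \<and> amult A a (aunit A) = a)"

text \<open>The product \<open>(a \<otimes> b)(c \<otimes> d) = ac \<otimes> bd\<close> of \<open>A \<otimes> A\<close>.\<close>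

definition tmult :: "('k::field, 'a::ab_group_add, 'z) hopf_scheme \<Rightarrow>
    ('a, 'a, 'k) tensor \<Rightarrow> ('a, 'a, 'k) tensor \<Rightarrow> ('a, 'a, 'k) tensor" where
  "tmult A s t = tlift A A (A \<otimes> A)
     (\<lambda>a b. tlift A A (A \<otimes> A) (\<lambda>c d. tens A A (amult A a c) (amult A b d)) t) s"

definition hopf_algebra :: "('k::field, 'a::ab_group_add, 'z) hopf_scheme \<Rightarrow> bool" where
  "hopf_algebra A \<longleftrightarrow> unital_algebra A \<and> coalgebra A \<and>
     (\<forall>a\<in>vecs A. \<forall>b\<in>vecs A. comult A (amult A a b) = tmult A (comult A a) (comult A b)) \<and>
     comult A (aunit A) = tens A A (aunit A) (aunit A) \<and>
     (\<forall>a\<in>vecs A. \<forall>b\<in>vecs A. counit A (amult A a b) = counit A a * counit A b) \<and>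
     counit A (aunit A) = 1 \<and>
     lin A A (antipode A) \<and>
     (\<forall>a\<in>vecs A.
        tlift A A A (amult A) (tmap A A A A (antipode A) id (comult A a)) =
        scl A (counit A a) (aunit A)) \<and>
     (\<forall>a\<in>vecs A.
        tlift A A A (amult A) (tmap A A A A id (antipode A) (comult A a)) =
        scl A (counit A a) (aunit A))"

definition coalgebra_hom :: "('k::field, 'a::ab_group_add, 'y) coalg_scheme \<Rightarrow>
    ('k, 'c::ab_group_add, 'z) coalg_scheme \<Rightarrow> ('a \<Rightarrow> 'c) \<Rightarrow> bool" where
  "coalgebra_hom A C p \<longleftrightarrow> lin A C p \<and>
     (\<forall>a\<in>vecs A. comult C (p a) = tmap A A C C p p (comult A a)) \<and>
     (\<forall>a\<in>vecs A. counit C (p a) = counit A a)"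

text \<open>Compatibility with the antipodes follows and is therefore not required.\<close>

definition hopf_hom :: "('k::field, 'a::ab_group_add, 'y) hopf_scheme \<Rightarrow>
    ('k, 'b::ab_group_add, 'z) hopf_scheme \<Rightarrow> ('a \<Rightarrow> 'b) \<Rightarrow> bool" where
  "hopf_hom A B p \<longleftrightarrow> coalgebra_hom A B p \<and>
     (\<forall>x\<in>vecs A. \<forall>y\<in>vecs A. p (amult A x y) = amult B (p x) (p y)) \<and> p (aunit A) = aunit B"

section \<open>Modules and quantum subgroups\<close>

definition left_module :: "('k::field, 'a::ab_group_add, 'y) hopf_scheme \<Rightarrow>
    ('k, 'm::ab_group_add, 'z) vspace_scheme \<Rightarrow> ('a \<Rightarrow> 'm \<Rightarrow> 'm) \<Rightarrow> bool" where
  "left_module A M act \<longleftrightarrow> vec_space M \<and> bilin A M M act \<and>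
     (\<forall>a\<in>vecs A. \<forall>b\<in>vecs A. \<forall>m\<in>vecs M. act (amult A a b) m = act a (act b m)) \<and>
     (\<forall>m\<in>vecs M. act (aunit A) m = m)"

definition right_module :: "('k::field, 'a::ab_group_add, 'y) hopf_scheme \<Rightarrow>
    ('k, 'm::ab_group_add, 'z) vspace_scheme \<Rightarrow> ('m \<Rightarrow> 'a \<Rightarrow> 'm) \<Rightarrow> bool" where
  "right_module A M act \<longleftrightarrow> vec_space M \<and> bilin M A M act \<and>
     (\<forall>a\<in>vecs A. \<forall>b\<in>vecs A. \<forall>m\<in>vecs M. act m (amult A a b) = act (act m a) b) \<and>
     (\<forall>m\<in>vecs M. act m (aunit A) = m)"

definition quantum_subgroup :: "('k::field, 'a::ab_group_add, 'y) hopf_scheme \<Rightarrow>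
    ('k, 'b::ab_group_add, 'z) hopf_scheme \<Rightarrow> ('a \<Rightarrow> 'b) \<Rightarrow> bool" where
  "quantum_subgroup A B p \<longleftrightarrow>
     hopf_algebra A \<and> hopf_algebra B \<and> hopf_hom A B p \<and> p ` vecs A = vecs B"

text \<open>
  \<open>left_coisotropic_over A D actD C actC p\<close>: \<open>C\<close> is a coalgebra and a left \<open>A\<close>-module, and \<open>p\<close> is
  a surjective coalgebra and left \<open>A\<close>-module homomorphism from the coalgebra and left \<open>A\<close>-module
  \<open>D\<close> onto \<open>C\<close>.
\<close>

definition left_coisotropic_over :: "('k::field, 'a::ab_group_add, 'x) hopf_scheme \<Rightarrow>
    ('k, 'd::ab_group_add, 'y) coalg_scheme \<Rightarrow> ('a \<Rightarrow> 'd \<Rightarrow> 'd) \<Rightarrow>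
    ('k, 'c::ab_group_add, 'z) coalg_scheme \<Rightarrow> ('a \<Rightarrow> 'c \<Rightarrow> 'c) \<Rightarrow> ('d \<Rightarrow> 'c) \<Rightarrow> bool" where
  "left_coisotropic_over A D actD C actC p \<longleftrightarrow>
     coalgebra C \<and> left_module A C actC \<and> coalgebra_hom D C p \<and> p ` vecs D = vecs C \<and>
     (\<forall>a\<in>vecs A. \<forall>d\<in>vecs D. p (actD a d) = actC a (p d))"

definition right_coisotropic_over :: "('k::field, 'a::ab_group_add, 'x) hopf_scheme \<Rightarrow>
    ('k, 'd::ab_group_add, 'y) coalg_scheme \<Rightarrow> ('d \<Rightarrow> 'a \<Rightarrow> 'd) \<Rightarrow>
    ('k, 'c::ab_group_add, 'z) coalg_scheme \<Rightarrow> ('c \<Rightarrow> 'a \<Rightarrow> 'c) \<Rightarrow> ('d \<Rightarrow> 'c) \<Rightarrow> bool" where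
  "right_coisotropic_over A D actD C actC p \<longleftrightarrow>
     coalgebra C \<and> right_module A C actC \<and> coalgebra_hom D C p \<and> p ` vecs D = vecs C \<and>
     (\<forall>a\<in>vecs A. \<forall>d\<in>vecs D. p (actD d a) = actC (p d) a)"

definition left_coisotropic :: "('k::field, 'a::ab_group_add, 'y) hopf_scheme \<Rightarrow>
    ('k, 'c::ab_group_add, 'z) coalg_scheme \<Rightarrow> ('a \<Rightarrow> 'c \<Rightarrow> 'c) \<Rightarrow> ('a \<Rightarrow> 'c) \<Rightarrow> bool" where
  "left_coisotropic A C act p \<longleftrightarrow>
     hopf_algebra A \<and> left_coisotropic_over A A (amult A) C act p"

definition right_coisotropic :: "('k::field, 'a::ab_group_add, 'y) hopf_scheme \<Rightarrow>
    ('k, 'c::ab_group_add, 'z) coalg_scheme \<Rightarrow> ('c \<Rightarrow> 'a \<Rightarrow> 'c) \<Rightarrow> ('a \<Rightarrow> 'c) \<Rightarrow> bool" where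
  "right_coisotropic A C act p \<longleftrightarrow>
     hopf_algebra A \<and> right_coisotropic_over A A (amult A) C act p"

section \<open>Corepresentations and induction\<close>

text \<open>
  The third parameter is the codomain of the coaction: tensors of type \<open>('v, 'c, 'k) tensor\<close> for
  right and \<open>('c, 'v, 'k) tensor\<close> for left corepresentations.
\<close>

record ('k, 'v, 't) corep = "('k, 'v) vspace" +
  coact :: "'v \<Rightarrow> 't"

type_synonym ('k, 'v, 'c) rcorep = "('k, 'v, ('v, 'c, 'k) tensor) corep"
type_synonym ('k, 'v, 'c) lcorep = "('k, 'v, ('c, 'v, 'k) tensor) corep"

definition right_corep :: "('k::field, 'c::ab_group_add, 'z) coalg_scheme \<Rightarrow>
    ('k, 'v::ab_group_add, 'c) rcorep \<Rightarrow> bool" where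
  "right_corep C V \<longleftrightarrow> vec_space V \<and> lin V (V \<otimes> C) (coact V) \<and>
     (\<forall>v\<in>vecs V.
        tmap V C (V \<otimes> C) C (coact V) id (coact V v) =
        assoc_l V C C (tmap V C V (C \<otimes> C) id (comult C) (coact V v))) \<and>
     (\<forall>v\<in>vecs V. tlift V C V (\<lambda>x c. scl V (counit C c) x) (coact V v) = v)"

definition left_corep :: "('k::field, 'c::ab_group_add, 'z) coalg_scheme \<Rightarrow>
    ('k, 'v::ab_group_add, 'c) lcorep \<Rightarrow> bool" where
  "left_corep C V \<longleftrightarrow> vec_space V \<and> lin V (C \<otimes> V) (coact V) \<and>
     (\<forall>v\<in>vecs V.
        tmap C V (C \<otimes> C) V (comult C) id (coact V v) =
        assoc_l C C V (tmap C V C (C \<otimes> V) id (coact V) (coact V v))) \<and>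
     (\<forall>v\<in>vecs V. tlift C V V (\<lambda>c x. scl V (counit C c) x) (coact V v) = v)"

definition right_corep_equiv :: "('k::field, 'c::ab_group_add, 'z) coalg_scheme \<Rightarrow>
    ('k, 'v::ab_group_add, 'c) rcorep \<Rightarrow> ('k, 'w::ab_group_add, 'c) rcorep \<Rightarrow> bool" where
  "right_corep_equiv C V W \<longleftrightarrow> right_corep C V \<and> right_corep C W \<and>
     (\<exists>f. lin V W f \<and> bij_betw f (vecs V) (vecs W) \<and>
       (\<forall>v\<in>vecs V. coact W (f v) = tmap V C W C f id (coact V v)))"

definition left_corep_equiv :: "('k::field, 'c::ab_group_add, 'z) coalg_scheme \<Rightarrow>
    ('k, 'v::ab_group_add, 'c) lcorep \<Rightarrow> ('k, 'w::ab_group_add, 'c) lcorep \<Rightarrow> bool" where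
  "left_corep_equiv C V W \<longleftrightarrow> left_corep C V \<and> left_corep C W \<and>
     (\<exists>f. lin V W f \<and> bij_betw f (vecs V) (vecs W) \<and>
       (\<forall>v\<in>vecs V. coact W (f v) = tmap C V C W id f (coact V v)))"

definition L_coact :: "('k::field, 'x::ab_group_add, 'y) coalg_scheme \<Rightarrow>
    ('k, 'c::ab_group_add, 'z) coalg_scheme \<Rightarrow> ('x \<Rightarrow> 'c) \<Rightarrow> 'x \<Rightarrow> ('c, 'x, 'k) tensor" where
  "L_coact X Y p x = tmap X X Y X p id (comult X x)"

definition R_coact :: "('k::field, 'x::ab_group_add, 'y) coalg_scheme \<Rightarrow>
    ('k, 'c::ab_group_add, 'z) coalg_scheme \<Rightarrow> ('x \<Rightarrow> 'c) \<Rightarrow> 'x \<Rightarrow> ('x, 'c, 'k) tensor" where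
  "R_coact X Y p x = tmap X X X Y id p (comult X x)"

text \<open>
  The associators make explicit the identification of the two bracketings of a triple tensor
  product. The induced space is a subspace of \<open>V \<otimes> X\<close> (resp. \<open>X \<otimes> V\<close>) and its coaction is the
  restriction of \<open>id \<otimes> comult X\<close> (resp. \<open>comult X \<otimes> id\<close>).
\<close>

definition ind_right :: "('k::field, 'x::ab_group_add, 'y) coalg_scheme \<Rightarrow>
    ('k, 'c::ab_group_add, 'z) coalg_scheme \<Rightarrow> ('x \<Rightarrow> 'c) \<Rightarrow>
    ('k, 'v::ab_group_add, 'c) rcorep \<Rightarrow> ('k, ('v, 'x, 'k) tensor, 'x) rcorep" where
  "ind_right X Y p V =
     \<lparr>vecs = {F \<in> vecs (V \<otimes> X).
        assoc_l V Y X (tmap V X V (Y \<otimes> X) id (L_coact X Y p) F) =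
        tmap V X (V \<otimes> Y) X (coact V) id F},
      scl = scl (V \<otimes> X),
      coact = (\<lambda>F. assoc_l V X X (tmap V X V (X \<otimes> X) id (comult X) F))\<rparr>"

definition ind_left :: "('k::field, 'x::ab_group_add, 'y) coalg_scheme \<Rightarrow>
    ('k, 'c::ab_group_add, 'z) coalg_scheme \<Rightarrow> ('x \<Rightarrow> 'c) \<Rightarrow>
    ('k, 'v::ab_group_add, 'c) lcorep \<Rightarrow> ('k, ('x, 'v, 'k) tensor, 'x) lcorep" where
  "ind_left X Y p V =
     \<lparr>vecs = {F \<in> vecs (X \<otimes> V).
        tmap X V (X \<otimes> Y) V (R_coact X Y p) id F =
        assoc_l X Y V (tmap X V X (Y \<otimes> V) id (coact V) F)},
      scl = scl (X \<otimes> V),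
      coact = (\<lambda>F. assoc_r X X V (tmap X V (X \<otimes> X) V (comult X) id F))\<rparr>"

end

theory Submission
  imports Defs
begin

text \<open>
  Induction in stages is an isomorphism between two cotensor products, and its proof is
  coassociativity and counitality of the coproducts. Write \<open>p : G \<rightarrow> K\<close> and \<open>q : K \<rightarrow> H\<close> for the two
  projections, which in every case are coalgebra homomorphisms, and let \<open>V\<close> be a right
  corepresentation of \<open>H\<close>. In Sweedler notation the equivalence is
  \<open>v \<otimes> g \<mapsto> (v \<otimes> p(g\<^sub>1)) \<otimes> g\<^sub>2\<close>, from \<open>V \<otimes> G\<close> to \<open>(V \<otimes> K) \<otimes> G\<close>, and its inverse applies the
  counit of \<open>K\<close> to the middle factor.

  The linear map \<open>stretch V X Y p : v \<otimes> x \<mapsto> (v \<otimes> p(x\<^sub>1)) \<otimes> x\<^sub>2\<close> occurs in three roles: it is one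
  of the two maps whose equaliser is the induced space, it is the induced coaction when \<open>p = id\<close>,
  and it is the equivalence itself. The identity \<open>stretch_stretch\<close>, a form of coassociativity, thus
  shows that the equivalence takes values in \<open>ind K H V \<otimes> G\<close>, that its values satisfy the second
  induction condition, and that it intertwines the coactions. That the values lie in
  \<open>ind K H V \<otimes> G\<close>, and not only in \<open>(V \<otimes> K) \<otimes> G\<close>, also uses that tensoring over a field preserves
  equalisers (\<open>equalizer_tensor\<close>). The two counit laws of \<open>stretch\<close> give the inverse; the main
  point there is that the evaluation \<open>v \<otimes> k \<mapsto> \<epsilon>(k) v\<close> turns the map \<open>id \<otimes> q\<close> on \<open>ind K H V\<close> into
  the coaction of \<open>V\<close> (\<open>coact_cancel_ind_right\<close>).

  The statement for left corepresentations follows because a left corepresentation of \<open>C\<close> is a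
  right corepresentation of the co-opposite coalgebra. Left induction agrees with right induction
  for the co-opposite coalgebras only up to the flip of tensor factors (\<open>mirror_ind_left\<close>), so for
  the iterated induction one needs in addition that equivalent corepresentations induce equivalent
  ones (\<open>ind_right_equiv\<close>).
\<close>

section \<open>Linear maps between tensor products\<close>

text \<open>
  Including the conditions on the spaces lets composites and tensor products of maps be handled
  with hypotheses on the maps alone.
\<close>

definition lmap :: "('k::field, 'v::ab_group_add, 'y) vspace_scheme \<Rightarrow>
    ('k, 'w::ab_group_add, 'z) vspace_scheme \<Rightarrow> ('v \<Rightarrow> 'w) \<Rightarrow> bool" where
  "lmap V W f \<longleftrightarrow> vec_space V \<and> vec_space W \<and> lin V W f"

lemma lmap_vec_space:
  assumes "lmap V W f"
  shows "vec_space V" "vec_space W"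
  using assms by (auto simp: lmap_def)

lemma lmap_in: "lmap V W f \<Longrightarrow> v \<in> vecs V \<Longrightarrow> f v \<in> vecs W"
  by (auto simp: lmap_def lin_def)

lemma lmap_id: "vec_space V \<Longrightarrow> lmap V V id"
  by (auto simp: lmap_def lin_def)

lemma lmap_comp: "lmap V W g \<Longrightarrow> lmap U V f \<Longrightarrow> lmap U W (g \<circ> f)"
  by (auto simp: lmap_def lin_def)

lemma lmap_cong: "lmap V W f \<Longrightarrow> (\<And>v. v \<in> vecs V \<Longrightarrow> g v = f v) \<Longrightarrow> lmap V W g"
  unfolding lmap_def lin_def vec_space_def
  by (auto simp: module.subspace_add module.subspace_scale vector_space_def module_def)

lemma vecs_add: "vec_space V \<Longrightarrow> x \<in> vecs V \<Longrightarrow> y \<in> vecs V \<Longrightarrow> x + y \<in> vecs V"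
  and vecs_diff: "vec_space V \<Longrightarrow> x \<in> vecs V \<Longrightarrow> y \<in> vecs V \<Longrightarrow> x - y \<in> vecs V"
  and vecs_scl: "vec_space V \<Longrightarrow> x \<in> vecs V \<Longrightarrow> scl V c x \<in> vecs V"
  and vecs_0: "vec_space V \<Longrightarrow> 0 \<in> vecs V"
  unfolding vec_space_def vector_space_def
  by (auto simp: module_def module.subspace_def module.subspace_diff)

lemma tens_in: "vec_space V \<Longrightarrow> vec_space W \<Longrightarrow> v \<in> vecs V \<Longrightarrow> w \<in> vecs W \<Longrightarrow>
    tens V W v w \<in> vecs (V \<otimes> W)"
  using tens_bilin[of V W] by (auto simp: bilin_def lin_def)

lemma
  assumes "vec_space V" "vec_space W"
  shows lmap_tens_left: "w \<in> vecs W \<Longrightarrow> lmap V (V \<otimes> W) (\<lambda>v. tens V W v w)"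
    and lmap_tens_right: "v \<in> vecs V \<Longrightarrow> lmap W (V \<otimes> W) (tens V W v)"
  using tens_bilin[OF assms] assms by (auto simp: bilin_def lmap_def vec_space_tensor)

lemma bilin_lmapI:
  assumes "vec_space V" "vec_space W"
    and "\<And>w. w \<in> vecs W \<Longrightarrow> lmap V U (\<lambda>v. b v w)" "\<And>v. v \<in> vecs V \<Longrightarrow> lmap W U (b v)"
  shows "bilin V W U b"
  using assms by (auto simp: bilin_def lmap_def)

lemma tensor_eqI:
  assumes "lmap (V \<otimes> W) U f" "lmap (V \<otimes> W) U g" "t \<in> vecs (V \<otimes> W)"
    and "\<And>v w. v \<in> vecs V \<Longrightarrow> w \<in> vecs W \<Longrightarrow> f (tens V W v w) = g (tens V W v w)"
  shows "f t = g t"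
  using assms lin_tensor_unique[of U V W f g t] by (auto simp: lmap_def)

text \<open>
  Two linear maps on a triple tensor product are compared on pure tensors; fixing the outer factor
  reduces this to the uniqueness for two factors.
\<close>

lemma tensor3_eqI:
  assumes f: "lmap (U \<otimes> (V \<otimes> W)) Z f" and g: "lmap (U \<otimes> (V \<otimes> W)) Z g"
    and t: "t \<in> vecs (U \<otimes> (V \<otimes> W))" and U: "vec_space U"
    and eq: "\<And>u v w. u \<in> vecs U \<Longrightarrow> v \<in> vecs V \<Longrightarrow> w \<in> vecs W \<Longrightarrow>
      f (tens U (V \<otimes> W) u (tens V W v w)) = g (tens U (V \<otimes> W) u (tens V W v w))"
  shows "f t = g t"
proof (rule tensor_eqI[OF f g t])
  fix u s assume u: "u \<in> vecs U" and s: "s \<in> vecs (V \<otimes> W)"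
  note r = lmap_tens_right[OF U vec_space_tensor u]
  have "(f \<circ> tens U (V \<otimes> W) u) s = (g \<circ> tens U (V \<otimes> W) u) s"
    by (rule tensor_eqI[OF lmap_comp[OF f r] lmap_comp[OF g r] s]) (simp add: eq u)
  then show "f (tens U (V \<otimes> W) u s) = g (tens U (V \<otimes> W) u s)" by simp
qed

lemma tensor3_left_eqI:
  assumes f: "lmap ((U \<otimes> V) \<otimes> W) Z f" and g: "lmap ((U \<otimes> V) \<otimes> W) Z g"
    and t: "t \<in> vecs ((U \<otimes> V) \<otimes> W)" and W: "vec_space W"
    and eq: "\<And>u v w. u \<in> vecs U \<Longrightarrow> v \<in> vecs V \<Longrightarrow> w \<in> vecs W \<Longrightarrow>
      f (tens (U \<otimes> V) W (tens U V u v) w) = g (tens (U \<otimes> V) W (tens U V u v) w)"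
  shows "f t = g t"
proof (rule tensor_eqI[OF f g t])
  fix s w assume s: "s \<in> vecs (U \<otimes> V)" and w: "w \<in> vecs W"
  note r = lmap_tens_left[OF vec_space_tensor W w]
  have "(f \<circ> (\<lambda>s. tens (U \<otimes> V) W s w)) s = (g \<circ> (\<lambda>s. tens (U \<otimes> V) W s w)) s"
    by (rule tensor_eqI[OF lmap_comp[OF f r] lmap_comp[OF g r] s]) (simp add: eq w)
  then show "f (tens (U \<otimes> V) W s w) = g (tens (U \<otimes> V) W s w)" by simp
qed

lemma lmap_tlift:
  assumes "vec_space V" "vec_space W" "vec_space U" "bilin V W U b"
  shows "lmap (V \<otimes> W) U (tlift V W U b)"
  using tlift_lin[OF assms] assms by (auto simp: lmap_def vec_space_tensor)

lemma
  assumes f: "lmap V V' f" and g: "lmap W W' g"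
  shows lmap_tmap: "lmap (V \<otimes> W) (V' \<otimes> W') (tmap V W V' W' f g)"
    and tmap_tens: "v \<in> vecs V \<Longrightarrow> w \<in> vecs W \<Longrightarrow>
      tmap V W V' W' f g (tens V W v w) = tens V' W' (f v) (g w)"
proof -
  note vs = lmap_vec_space[OF f] lmap_vec_space[OF g] vec_space_tensor[of V' W']
  have b: "bilin V W (V' \<otimes> W') (\<lambda>v w. tens V' W' (f v) (g w))"
  proof (rule bilin_lmapI)
    show "lmap V (V' \<otimes> W') (\<lambda>v. tens V' W' (f v) (g w))" if "w \<in> vecs W" for w
      using lmap_comp[OF lmap_tens_left[OF vs(2,4)] f] lmap_in[OF g that] by (simp add: o_def)
    show "lmap W (V' \<otimes> W') (\<lambda>w. tens V' W' (f v) (g w))" if "v \<in> vecs V" for v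
      using lmap_comp[OF lmap_tens_right[OF vs(2,4)] g] lmap_in[OF f that] by (simp add: o_def)
  qed (use vs in auto)
  show "lmap (V \<otimes> W) (V' \<otimes> W') (tmap V W V' W' f g)"
    unfolding tmap_def by (rule lmap_tlift) (use vs b in auto)
  show "v \<in> vecs V \<Longrightarrow> w \<in> vecs W \<Longrightarrow>
      tmap V W V' W' f g (tens V W v w) = tens V' W' (f v) (g w)"
    unfolding tmap_def using tlift_tens[OF _ _ _ b] vs by auto
qed

lemma tmap_in: "lmap V V' f \<Longrightarrow> lmap W W' g \<Longrightarrow> t \<in> vecs (V \<otimes> W) \<Longrightarrow>
    tmap V W V' W' f g t \<in> vecs (V' \<otimes> W')"
  using lmap_in[OF lmap_tmap] .

lemma tmap_comp:
  assumes f: "lmap V V' f" and g: "lmap W W' g" and f': "lmap V' V'' f'" and g': "lmap W' W'' g'"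
    and t: "t \<in> vecs (V \<otimes> W)"
  shows "tmap V' W' V'' W'' f' g' (tmap V W V' W' f g t) = tmap V W V'' W'' (f' \<circ> f) (g' \<circ> g) t"
proof -
  note ff = lmap_comp[OF f' f] and gg = lmap_comp[OF g' g]
  have "(tmap V' W' V'' W'' f' g' \<circ> tmap V W V' W' f g) t = tmap V W V'' W'' (f' \<circ> f) (g' \<circ> g) t"
    by (rule tensor_eqI[OF lmap_comp[OF lmap_tmap[OF f' g'] lmap_tmap[OF f g]] lmap_tmap[OF ff gg] t])
      (simp add: tmap_tens[OF f g] tmap_tens[OF f' g'] tmap_tens[OF ff gg] lmap_in[OF f] lmap_in[OF g])
  then show ?thesis by simp
qed

lemma tmap_cong:
  assumes f: "lmap V V' f" and g: "lmap W W' g" and t: "t \<in> vecs (V \<otimes> W)"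
    and eq: "\<And>v. v \<in> vecs V \<Longrightarrow> f' v = f v" "\<And>w. w \<in> vecs W \<Longrightarrow> g' w = g w"
  shows "tmap V W V' W' f' g' t = tmap V W V' W' f g t"
proof -
  note f' = lmap_cong[OF f eq(1)] and g' = lmap_cong[OF g eq(2)]
  show ?thesis
    by (rule tensor_eqI[OF lmap_tmap[OF f' g'] lmap_tmap[OF f g] t])
      (simp_all add: tmap_tens[OF f g] tmap_tens[OF f' g'] eq)
qed

lemma tmap_id:
  assumes "vec_space V" "vec_space W" "t \<in> vecs (V \<otimes> W)"
  shows "tmap V W V W id id t = t"
proof -
  note i = lmap_id[OF assms(1)] lmap_id[OF assms(2)]
  have "tmap V W V W id id t = id t"
    by (rule tensor_eqI[OF lmap_tmap[OF i] lmap_id[OF vec_space_tensor] assms(3)])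
      (simp add: tmap_tens[OF i])
  then show ?thesis by simp
qed

section \<open>Associators\<close>

text \<open>
  A trilinear map may be extended linearly in two of its arguments at a time: additivity and
  homogeneity in the parameter are equations between linear maps on \<open>V \<otimes> W\<close>, so they may be checked
  on pure tensors. Both associators are instances.
\<close>

lemma bilin_tlift:
  assumes P: "vec_space P" and V: "vec_space V" and W: "vec_space W" and Z: "vec_space Z"
    and b: "\<And>p. p \<in> vecs P \<Longrightarrow> bilin V W Z (T p)"
    and l: "\<And>v w. v \<in> vecs V \<Longrightarrow> w \<in> vecs W \<Longrightarrow> lmap P Z (\<lambda>p. T p v w)"
  shows "bilin P (V \<otimes> W) Z (\<lambda>p. tlift V W Z (T p))"
proof -
  interpret z: vector_space "scl Z" using Z by (simp add: vec_space_def)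
  have i: "lmap (V \<otimes> W) Z (tlift V W Z (T p))" if "p \<in> vecs P" for p
    using lmap_tlift[OF V W Z b[OF that]] .
  have i_tens: "tlift V W Z (T p) (tens V W v w) = T p v w"
    if "p \<in> vecs P" "v \<in> vecs V" "w \<in> vecs W" for p v w
    using tlift_tens[OF V W Z b] that by auto
  have add: "tlift V W Z (T (p + q)) s = tlift V W Z (T p) s + tlift V W Z (T q) s"
    if p: "p \<in> vecs P" and q: "q \<in> vecs P" and s: "s \<in> vecs (V \<otimes> W)" for p q s
  proof (rule tensor_eqI[OF i[OF vecs_add[OF P p q]] _ s])
    show "lmap (V \<otimes> W) Z (\<lambda>s. tlift V W Z (T p) s + tlift V W Z (T q) s)"
      using i[OF p] i[OF q] vecs_add[OF Z]
      by (simp add: lmap_def lin_def z.scale_right_distrib)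
    show "tlift V W Z (T (p + q)) (tens V W v w) =
        tlift V W Z (T p) (tens V W v w) + tlift V W Z (T q) (tens V W v w)"
      if "v \<in> vecs V" "w \<in> vecs W" for v w
      using l[OF that] i_tens that p q vecs_add[OF P p q] by (simp add: lmap_def lin_def)
  qed
  have scal: "tlift V W Z (T (scl P c p)) s = scl Z c (tlift V W Z (T p) s)"
    if p: "p \<in> vecs P" and s: "s \<in> vecs (V \<otimes> W)" for c p s
  proof (rule tensor_eqI[OF i[OF vecs_scl[OF P p]] _ s])
    show "lmap (V \<otimes> W) Z (\<lambda>s. scl Z c (tlift V W Z (T p) s))"
      using i[OF p] vecs_scl[OF Z]
      by (simp add: lmap_def lin_def z.scale_right_distrib mult.commute)
    show "tlift V W Z (T (scl P c p)) (tens V W v w) = scl Z c (tlift V W Z (T p) (tens V W v w))"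
      if "v \<in> vecs V" "w \<in> vecs W" for v w
      using l[OF that] i_tens that p vecs_scl[OF P p] by (simp add: lmap_def lin_def)
  qed
  show ?thesis
    using add scal lmap_in[OF i] i by (auto simp: bilin_def lmap_def lin_def)
qed

lemma
  assumes U: "vec_space U" and V: "vec_space V" and W: "vec_space W"
  shows lmap_assoc_l: "lmap (U \<otimes> (V \<otimes> W)) ((U \<otimes> V) \<otimes> W) (assoc_l U V W)"
    and assoc_l_tens: "u \<in> vecs U \<Longrightarrow> v \<in> vecs V \<Longrightarrow> w \<in> vecs W \<Longrightarrow>
      assoc_l U V W (tens U (V \<otimes> W) u (tens V W v w)) = tens (U \<otimes> V) W (tens U V u v) w"
proof -
  let ?Z = "(U \<otimes> V) \<otimes> W"
  let ?T = "\<lambda>u v w. tens (U \<otimes> V) W (tens U V u v) w"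
  have b: "bilin V W ?Z (?T u)" if u: "u \<in> vecs U" for u
  proof (rule bilin_lmapI[OF V W])
    show "lmap V ?Z (\<lambda>v. ?T u v w)" if "w \<in> vecs W" for w
      using lmap_comp[OF lmap_tens_left[OF vec_space_tensor W that] lmap_tens_right[OF U V u]]
      by (simp add: o_def)
    show "lmap W ?Z (?T u v)" if "v \<in> vecs V" for v
      using lmap_tens_right[OF vec_space_tensor W tens_in[OF U V u that]] .
  qed
  have u: "lmap U ?Z (\<lambda>u. ?T u v w)" if "v \<in> vecs V" "w \<in> vecs W" for v w
    using lmap_comp[OF lmap_tens_left[OF vec_space_tensor W that(2)] lmap_tens_left[OF U V that(1)]]
    by (simp add: o_def)
  note bb = bilin_tlift[OF U V W vec_space_tensor b u]
  show "lmap (U \<otimes> (V \<otimes> W)) ?Z (assoc_l U V W)"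
    unfolding assoc_l_def by (rule lmap_tlift[OF U vec_space_tensor vec_space_tensor bb])
  show "assoc_l U V W (tens U (V \<otimes> W) u (tens V W v w)) = ?T u v w"
    if "u \<in> vecs U" "v \<in> vecs V" "w \<in> vecs W"
    unfolding assoc_l_def
    using tlift_tens[OF U vec_space_tensor vec_space_tensor bb that(1) tens_in[OF V W that(2,3)]]
      tlift_tens[OF V W vec_space_tensor b[OF that(1)] that(2,3)] by simp
qed

lemma
  assumes U: "vec_space U" and V: "vec_space V" and W: "vec_space W"
  shows lmap_assoc_r: "lmap ((U \<otimes> V) \<otimes> W) (U \<otimes> (V \<otimes> W)) (assoc_r U V W)"
    and assoc_r_tens: "u \<in> vecs U \<Longrightarrow> v \<in> vecs V \<Longrightarrow> w \<in> vecs W \<Longrightarrow>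
      assoc_r U V W (tens (U \<otimes> V) W (tens U V u v) w) = tens U (V \<otimes> W) u (tens V W v w)"
proof -
  let ?Z = "U \<otimes> (V \<otimes> W)"
  let ?T = "\<lambda>w u v. tens U (V \<otimes> W) u (tens V W v w)"
  have b: "bilin U V ?Z (?T w)" if w: "w \<in> vecs W" for w
  proof (rule bilin_lmapI[OF U V])
    show "lmap U ?Z (\<lambda>u. ?T w u v)" if "v \<in> vecs V" for v
      using lmap_tens_left[OF U vec_space_tensor tens_in[OF V W that w]] .
    show "lmap V ?Z (?T w u)" if "u \<in> vecs U" for u
      using lmap_comp[OF lmap_tens_right[OF U vec_space_tensor that] lmap_tens_left[OF V W w]]
      by (simp add: o_def)
  qed
  have w: "lmap W ?Z (\<lambda>w. ?T w u v)" if "u \<in> vecs U" "v \<in> vecs V" for u v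
    using lmap_comp[OF lmap_tens_right[OF U vec_space_tensor that(1)] lmap_tens_right[OF V W that(2)]]
    by (simp add: o_def)
  have bb: "bilin (U \<otimes> V) W ?Z (\<lambda>t w. tlift U V ?Z (?T w) t)"
    using bilin_tlift[OF W U V vec_space_tensor b w] by (auto simp: bilin_def)
  show "lmap ((U \<otimes> V) \<otimes> W) ?Z (assoc_r U V W)"
    unfolding assoc_r_def by (rule lmap_tlift[OF vec_space_tensor W vec_space_tensor bb])
  show "assoc_r U V W (tens (U \<otimes> V) W (tens U V u v) w) = ?T w u v"
    if "u \<in> vecs U" "v \<in> vecs V" "w \<in> vecs W"
    unfolding assoc_r_def
    using tlift_tens[OF vec_space_tensor W vec_space_tensor bb tens_in[OF U V that(1,2)] that(3)]
      tlift_tens[OF U V vec_space_tensor b[OF that(3)] that(1,2)] by simp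
qed

lemma assoc_r_assoc_l:
  assumes U: "vec_space U" and V: "vec_space V" and W: "vec_space W"
    and t: "t \<in> vecs (U \<otimes> (V \<otimes> W))"
  shows "assoc_r U V W (assoc_l U V W t) = t"
proof -
  have "(assoc_r U V W \<circ> assoc_l U V W) t = id t"
    by (rule tensor3_eqI[OF lmap_comp[OF lmap_assoc_r[OF U V W] lmap_assoc_l[OF U V W]]
          lmap_id[OF vec_space_tensor] t U])
      (simp add: assoc_l_tens[OF U V W] assoc_r_tens[OF U V W])
  then show ?thesis by simp
qed

lemma assoc_l_natural:
  assumes f: "lmap U U' f" and g: "lmap V V' g" and h: "lmap W W' h"
    and t: "t \<in> vecs (U \<otimes> (V \<otimes> W))"
  shows "assoc_l U' V' W' (tmap U (V \<otimes> W) U' (V' \<otimes> W') f (tmap V W V' W' g h) t) =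
    tmap (U \<otimes> V) W (U' \<otimes> V') W' (tmap U V U' V' f g) h (assoc_l U V W t)"
proof -
  note s = lmap_vec_space(1)[OF f] lmap_vec_space(1)[OF g] lmap_vec_space(1)[OF h]
  note s' = lmap_vec_space(2)[OF f] lmap_vec_space(2)[OF g] lmap_vec_space(2)[OF h]
  note gh = lmap_tmap[OF g h] and fg = lmap_tmap[OF f g]
  have "(assoc_l U' V' W' \<circ> tmap U (V \<otimes> W) U' (V' \<otimes> W') f (tmap V W V' W' g h)) t =
    (tmap (U \<otimes> V) W (U' \<otimes> V') W' (tmap U V U' V' f g) h \<circ> assoc_l U V W) t"
    by (rule tensor3_eqI[OF lmap_comp[OF lmap_assoc_l[OF s'] lmap_tmap[OF f gh]]
          lmap_comp[OF lmap_tmap[OF fg h] lmap_assoc_l[OF s]] t s(1)])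
      (simp add: assoc_l_tens[OF s] assoc_l_tens[OF s'] tmap_tens[OF f g] tmap_tens[OF g h]
        tmap_tens[OF f gh] tmap_tens[OF fg h] lmap_in[OF f] lmap_in[OF g] lmap_in[OF h]
        tens_in[OF s(1,2)] tens_in[OF s(2,3)])
  then show ?thesis by simp
qed

text \<open>
  The pentagon identity. Besides naturality it is the only fact about bracketings that
  \<open>stretch_stretch\<close> below requires.
\<close>

lemma assoc_l_pentagon:
  assumes U: "vec_space U" and V: "vec_space V" and W: "vec_space W" and X: "vec_space X"
    and t: "t \<in> vecs (U \<otimes> (V \<otimes> (W \<otimes> X)))"
  shows "tmap (U \<otimes> (V \<otimes> W)) X ((U \<otimes> V) \<otimes> W) X (assoc_l U V W) id
      (assoc_l U (V \<otimes> W) X (tmap U (V \<otimes> (W \<otimes> X)) U ((V \<otimes> W) \<otimes> X) id (assoc_l V W X) t)) =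
    assoc_l (U \<otimes> V) W X (assoc_l U V (W \<otimes> X) t)"
proof -
  let ?l = "\<lambda>t. tmap (U \<otimes> (V \<otimes> W)) X ((U \<otimes> V) \<otimes> W) X (assoc_l U V W) id
      (assoc_l U (V \<otimes> W) X (tmap U (V \<otimes> (W \<otimes> X)) U ((V \<otimes> W) \<otimes> X) id (assoc_l V W X) t))"
  let ?r = "\<lambda>t. assoc_l (U \<otimes> V) W X (assoc_l U V (W \<otimes> X) t)"
  note vt = vec_space_tensor
  note i = lmap_id[OF U] lmap_id[OF X]
  note a = lmap_assoc_l[OF U V W] lmap_assoc_l[OF V W X] lmap_assoc_l[OF U vt X]
    lmap_assoc_l[OF U V vt] lmap_assoc_l[OF vt W X]
  have l: "lmap (U \<otimes> (V \<otimes> (W \<otimes> X))) (((U \<otimes> V) \<otimes> W) \<otimes> X) ?l"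
    using lmap_comp[OF lmap_tmap[OF a(1) i(2)] lmap_comp[OF a(3) lmap_tmap[OF i(1) a(2)]]]
    by (simp add: o_def)
  have r: "lmap (U \<otimes> (V \<otimes> (W \<otimes> X))) (((U \<otimes> V) \<otimes> W) \<otimes> X) ?r"
    using lmap_comp[OF a(5,4)] by (simp add: o_def)
  show ?thesis
  proof (rule tensor_eqI[OF l r t])
    fix u s assume u: "u \<in> vecs U" and s: "s \<in> vecs (V \<otimes> (W \<otimes> X))"
    note e = lmap_tens_right[OF U vt u]
    have "(?l \<circ> tens U (V \<otimes> (W \<otimes> X)) u) s = (?r \<circ> tens U (V \<otimes> (W \<otimes> X)) u) s"
      by (rule tensor3_eqI[OF lmap_comp[OF l e] lmap_comp[OF r e] s V])
        (simp add: u assoc_l_tens U V W X vt tens_in tmap_tens[OF i(1) a(2)] tmap_tens[OF a(1) i(2)])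
    then show "?l (tens U (V \<otimes> (W \<otimes> X)) u s) = ?r (tens U (V \<otimes> (W \<otimes> X)) u s)" by simp
  qed
qed

section \<open>Tensor products of subspaces\<close>

text \<open>
  An induced space is a subspace of a tensor product and carries a coaction restricted from it. The
  lemmas of this section make the passage between maps on \<open>M \<otimes> N\<close> and on \<open>A \<otimes> B\<close> explicit. The scalar
  multiplications have to agree on the whole type, because pure tensors are functionals on the
  bilinear forms of the ambient types.
\<close>

definition subsp :: "('k::field, 'v::ab_group_add, 'y) vspace_scheme \<Rightarrow>
    ('k, 'v, 'z) vspace_scheme \<Rightarrow> bool" where
  "subsp M A \<longleftrightarrow> vec_space M \<and> vec_space A \<and> vecs M \<subseteq> vecs A \<and> scl M = scl A"

lemma subsp_refl: "vec_space A \<Longrightarrow> subsp A A"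
  by (simp add: subsp_def)

lemma subsp_vec_space:
  assumes "subsp M A"
  shows "vec_space M" "vec_space A"
  using assms by (auto simp: subsp_def)

lemma subsp_in: "subsp M A \<Longrightarrow> v \<in> vecs M \<Longrightarrow> v \<in> vecs A"
  by (auto simp: subsp_def)

lemma lmap_restrict: "subsp M A \<Longrightarrow> lmap A B f \<Longrightarrow> lmap M B f"
  by (simp add: subsp_def lmap_def lin_def subset_iff)

lemma lmap_extend: "subsp N B \<Longrightarrow> lmap A N f \<Longrightarrow> lmap A B f"
  by (simp add: subsp_def lmap_def lin_def subset_iff)

lemma lmap_corestrict: "subsp N B \<Longrightarrow> lmap A B f \<Longrightarrow> (\<And>v. v \<in> vecs A \<Longrightarrow> f v \<in> vecs N) \<Longrightarrow> lmap A N f"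
  by (auto simp: subsp_def lmap_def lin_def)

lemma tens_subsp: "subsp M A \<Longrightarrow> subsp N B \<Longrightarrow> tens M N = tens A B"
  by (simp add: subsp_def tens_def[abs_def] bilinear_form_def)

lemma subsp_tensor:
  fixes M :: "('k::field, 'v::ab_group_add, 'y) vspace_scheme"
    and N :: "('k, 'w::ab_group_add, 'z) vspace_scheme"
  assumes M: "subsp M A" and N: "subsp N B"
  shows "subsp (M \<otimes> N) (A \<otimes> B)"
proof -
  interpret t: vector_space "tscl :: 'k \<Rightarrow> ('v, 'w, 'k) tensor \<Rightarrow> _"
    by (rule tscl_vector_space)
  have "vecs (M \<otimes> N) \<subseteq> vecs (A \<otimes> B)"
    unfolding tensor_space_def tens_subsp[OF M N] vspace.select_convs
    by (rule t.span_mono) (use subsp_in[OF M] subsp_in[OF N] in blast)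
  then show ?thesis by (auto simp: subsp_def vec_space_tensor) (simp_all add: tensor_space_def)
qed

lemma tmap_subsp_source:
  assumes M: "subsp M A" and N: "subsp N B" and f: "lmap A A' f" and g: "lmap B B' g"
    and t: "t \<in> vecs (M \<otimes> N)"
  shows "tmap M N A' B' f g t = tmap A B A' B' f g t"
  by (rule tensor_eqI[OF lmap_tmap[OF lmap_restrict[OF M f] lmap_restrict[OF N g]]
        lmap_restrict[OF subsp_tensor[OF M N] lmap_tmap[OF f g]] t])
    (simp add: tmap_tens[OF lmap_restrict[OF M f] lmap_restrict[OF N g], unfolded tens_subsp[OF M N]]
      tens_subsp[OF M N] tmap_tens[OF f g] subsp_in[OF M] subsp_in[OF N])

lemma tmap_subsp_target:
  assumes M: "subsp M' A'" and N: "subsp N' B'" and f: "lmap A M' f" and g: "lmap B N' g"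
    and t: "t \<in> vecs (A \<otimes> B)"
  shows "tmap A B M' N' f g t = tmap A B A' B' f g t"
  by (rule tensor_eqI[OF lmap_extend[OF subsp_tensor[OF M N] lmap_tmap[OF f g]]
        lmap_tmap[OF lmap_extend[OF M f] lmap_extend[OF N g]] t])
    (simp add: tmap_tens[OF lmap_extend[OF M f] lmap_extend[OF N g]] tens_subsp[OF M N]
      tmap_tens[OF f g])

lemma assoc_l_subsp:
  assumes U: "subsp U U'" and V: "subsp V V'" and W: "subsp W W'"
    and t: "t \<in> vecs (U \<otimes> (V \<otimes> W))"
  shows "assoc_l U V W t = assoc_l U' V' W' t"
proof -
  note s = subsp_vec_space(1)[OF U] subsp_vec_space(1)[OF V] subsp_vec_space(1)[OF W]
  note s' = subsp_vec_space(2)[OF U] subsp_vec_space(2)[OF V] subsp_vec_space(2)[OF W]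
  note UV = subsp_tensor[OF U V] and VW = subsp_tensor[OF V W]
  note e = tens_subsp[OF U V] tens_subsp[OF V W] tens_subsp[OF U VW] tens_subsp[OF UV W]
  show ?thesis
    by (rule tensor3_eqI[OF lmap_extend[OF subsp_tensor[OF UV W] lmap_assoc_l[OF s]]
        lmap_restrict[OF subsp_tensor[OF U VW] lmap_assoc_l[OF s']] t s(1)])
      (use assoc_l_tens[OF s] assoc_l_tens[OF s'] subsp_in[OF U] subsp_in[OF V] subsp_in[OF W]
        in \<open>simp add: e\<close>)
qed

text \<open>
  Every linear map over a field is von Neumann regular: choose a linear right inverse on its image.
\<close>

lemma linear_generalized_inverse:
  assumes f: "lmap A B f"
  obtains r where "lmap B A r" "\<And>a. a \<in> vecs A \<Longrightarrow> f (r (f a)) = f a"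
proof -
  note s = lmap_vec_space[OF f]
  interpret a: vector_space "scl A" using s(1) by (simp add: vec_space_def)
  interpret b: vector_space "scl B" using s(2) by (simp add: vec_space_def)
  interpret ab: vector_space_pair "scl A" "scl B" ..
  obtain p where p: "Vector_Spaces.linear (scl A) (scl A) p" "range p \<subseteq> vecs A"
    "\<And>v. v \<in> vecs A \<Longrightarrow> p v = v" using subspace_projection[OF s(1)] by blast
  have pA: "p v \<in> vecs A" for v using p(2) by auto
  have "Vector_Spaces.linear (scl A) (scl B) (f \<circ> p)"
    using f p(1) pA b.vector_space_axioms by (auto simp: lmap_def lin_def Vector_Spaces.linear_iff)
  from ab.linear_exists_right_inverse_on[OF this, of "vecs A"] s(1)
  obtain r where r: "range r \<subseteq> vecs A" "Vector_Spaces.linear (scl B) (scl A) r"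
    "\<forall>v\<in>(f \<circ> p) ` vecs A. (f \<circ> p) (r v) = v" by (auto simp: vec_space_def)
  have rA: "r v \<in> vecs A" for v using r(1) by auto
  show ?thesis
  proof
    show "lmap B A r" using s r(2) rA by (auto simp: lmap_def lin_def Vector_Spaces.linear_iff)
    show "f (r (f a)) = f a" if "a \<in> vecs A" for a
      using bspec[OF r(3) imageI[OF that]] p(3)[OF that] p(3)[OF rA] by simp
  qed
qed

lemma lmap_diff:
  assumes f: "lmap A B f" and g: "lmap A B g"
  shows "lmap A B (\<lambda>a. f a - g a)"
proof -
  note s = lmap_vec_space[OF f]
  interpret b: vector_space "scl B" using s(2) by (simp add: vec_space_def)
  show ?thesis
    using f g vecs_diff[OF s(2)] by (simp add: lmap_def lin_def b.scale_right_diff_distrib)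
qed

lemma lmap_minus: "lmap A B f \<Longrightarrow> x \<in> vecs A \<Longrightarrow> y \<in> vecs A \<Longrightarrow> f (x - y) = f x - f y"
proof -
  assume f: "lmap A B f" and x: "x \<in> vecs A" and y: "y \<in> vecs A"
  then have "f (x - y + y) = f (x - y) + f y"
    using vecs_diff[of A x y] unfolding lmap_def lin_def by blast
  then show ?thesis by simp
qed

lemma tmap_diff:
  assumes f: "lmap A B f" and g: "lmap A B g" and h: "lmap X Y h" and t: "t \<in> vecs (A \<otimes> X)"
  shows "tmap A X B Y (\<lambda>a. f a - g a) h t = tmap A X B Y f h t - tmap A X B Y g h t"
proof (rule tensor_eqI[OF lmap_tmap[OF lmap_diff[OF f g] h]
      lmap_diff[OF lmap_tmap[OF f h] lmap_tmap[OF g h]] t])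
  fix v w assume v: "v \<in> vecs A" and w: "w \<in> vecs X"
  note l = lmap_tens_left[OF lmap_vec_space(2)[OF f] lmap_vec_space(2)[OF h] lmap_in[OF h w]]
  show "tmap A X B Y (\<lambda>a. f a - g a) h (tens A X v w) =
      tmap A X B Y f h (tens A X v w) - tmap A X B Y g h (tens A X v w)"
    using lmap_minus[OF l lmap_in[OF f v] lmap_in[OF g v]]
    by (simp add: tmap_tens[OF lmap_diff[OF f g] h] tmap_tens[OF f h] tmap_tens[OF g h] v w)
qed

text \<open>
  Tensoring over a field preserves equalisers. The difference \<open>h\<close> of the two maps has a
  generalised inverse \<open>r\<close>, so \<open>k = id - r h\<close> maps into the equaliser; and \<open>k \<otimes> id\<close> fixes every
  tensor that \<open>h \<otimes> id\<close> kills.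
\<close>

lemma equalizer_tensor:
  assumes f: "lmap A B f" and g: "lmap A B g" and X: "vec_space X" and M: "subsp M A"
    and eq: "vecs M = {a \<in> vecs A. f a = g a}"
    and t: "t \<in> vecs (A \<otimes> X)" and ft: "tmap A X B X f id t = tmap A X B X g id t"
  shows "t \<in> vecs (M \<otimes> X)"
proof -
  define h where "h a = f a - g a" for a
  have h: "lmap A B h" unfolding h_def by (rule lmap_diff[OF f g])
  obtain r where r: "lmap B A r" "\<And>a. a \<in> vecs A \<Longrightarrow> h (r (h a)) = h a"
    using linear_generalized_inverse[OF h] by blast
  note s = lmap_vec_space[OF f] and iX = lmap_id[OF X]
  define k where "k a = id a - (r \<circ> h) a" for a
  have k: "lmap A A k" unfolding k_def by (rule lmap_diff[OF lmap_id[OF s(1)] lmap_comp[OF r(1) h]])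
  have hk: "h (k a) = 0" if "a \<in> vecs A" for a
    using lmap_minus[OF h, of a "r (h a)"] that r lmap_in[OF r(1)] lmap_in[OF h] by (simp add: k_def)
  have kM: "lmap A M k"
    by (rule lmap_corestrict[OF M k]) (use hk lmap_in[OF k] in \<open>auto simp: eq h_def\<close>)
  have h0: "tmap A X B X h id t = 0"
    unfolding h_def by (simp add: tmap_diff[OF f g iX t] ft)
  have "tmap A X A X (r \<circ> h) id t = tmap B X A X r id (tmap A X B X h id t)"
    by (simp add: tmap_comp[OF h iX r(1) iX t])
  also have "\<dots> = 0"
    using lmap_minus[OF lmap_tmap[OF r(1) iX], of "0" "0"] by (simp add: h0 vecs_0 vec_space_tensor)
  finally have rh0: "tmap A X A X (r \<circ> h) id t = 0" .
  have "tmap A X A X k id t = t"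
    unfolding k_def tmap_diff[OF lmap_id[OF s(1)] lmap_comp[OF r(1) h] iX t]
    by (simp add: rh0 tmap_id[OF s(1) X t])
  then have "tmap A X M X k id t = t"
    by (simp add: tmap_subsp_target[OF M subsp_refl[OF X] kM iX t])
  then show ?thesis using tmap_in[OF kM iX t] by simp
qed

section \<open>Coactions on tensor products\<close>

definition cancel_r :: "('k::field, 'v::ab_group_add, 'y) vspace_scheme \<Rightarrow>
    ('k, 'c::ab_group_add, 'z) coalg_scheme \<Rightarrow> ('v, 'c, 'k) tensor \<Rightarrow> 'v" where
  "cancel_r V C = tlift V C V (\<lambda>v c. scl V (counit C c) v)"

definition cancel_l :: "('k::field, 'c::ab_group_add, 'z) coalg_scheme \<Rightarrow>
    ('k, 'v::ab_group_add, 'y) vspace_scheme \<Rightarrow> ('c, 'v, 'k) tensor \<Rightarrow> 'v" where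
  "cancel_l C V = tlift C V V (\<lambda>c v. scl V (counit C c) v)"

lemma
  assumes "coalgebra C"
  shows coalgebra_vec_space: "vec_space C"
    and lmap_comult: "lmap C (C \<otimes> C) (comult C)"
    and lin_counit: "lin C ground (counit C)"
    and coassoc: "c \<in> vecs C \<Longrightarrow> tmap C C (C \<otimes> C) C (comult C) id (comult C c) =
        assoc_l C C C (tmap C C C (C \<otimes> C) id (comult C) (comult C c))"
    and counit_l: "c \<in> vecs C \<Longrightarrow> cancel_l C C (comult C c) = c"
    and counit_r: "c \<in> vecs C \<Longrightarrow> cancel_r C C (comult C c) = c"
  using assms by (auto simp: coalgebra_def lmap_def vec_space_tensor cancel_l_def cancel_r_def)

lemma bilin_counit:
  assumes V: "vec_space V" and C: "coalgebra C"
  shows "bilin C V V (\<lambda>c v. scl V (counit C c) v)" "bilin V C V (\<lambda>v c. scl V (counit C c) v)"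
proof -
  interpret v: vector_space "scl V" using V by (simp add: vec_space_def)
  show "bilin C V V (\<lambda>c v. scl V (counit C c) v)" "bilin V C V (\<lambda>v c. scl V (counit C c) v)"
    using vecs_scl[OF V] lin_counit[OF C]
    by (simp_all add: bilin_def lin_def ground_def v.scale_right_distrib v.scale_left_distrib
        mult.commute)
qed

lemma
  assumes V: "vec_space V" and C: "coalgebra C"
  shows lmap_cancel_r: "lmap (V \<otimes> C) V (cancel_r V C)"
    and cancel_r_tens: "v \<in> vecs V \<Longrightarrow> c \<in> vecs C \<Longrightarrow>
      cancel_r V C (tens V C v c) = scl V (counit C c) v"
    and lmap_cancel_l: "lmap (C \<otimes> V) V (cancel_l C V)"
    and cancel_l_tens: "v \<in> vecs V \<Longrightarrow> c \<in> vecs C \<Longrightarrow>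
      cancel_l C V (tens C V c v) = scl V (counit C c) v"
  unfolding cancel_r_def cancel_l_def
  using lmap_tlift[OF _ _ V bilin_counit(1)[OF V C]] lmap_tlift[OF _ _ V bilin_counit(2)[OF V C]]
    tlift_tens[OF _ _ V bilin_counit(1)[OF V C]] tlift_tens[OF _ _ V bilin_counit(2)[OF V C]]
    V coalgebra_vec_space[OF C] by auto

lemma lmap_scale: "lmap V W f \<Longrightarrow> v \<in> vecs V \<Longrightarrow> f (scl V c v) = scl W c (f v)"
  by (simp add: lmap_def lin_def)

lemma cancel_r_natural:
  assumes f: "lmap V W f" and C: "coalgebra C" and D: "coalgebra D" and p: "lmap C D p"
    and e: "\<And>c. c \<in> vecs C \<Longrightarrow> counit D (p c) = counit C c" and t: "t \<in> vecs (V \<otimes> C)"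
  shows "cancel_r W D (tmap V C W D f p t) = f (cancel_r V C t)"
proof -
  note V = lmap_vec_space(1)[OF f] and W = lmap_vec_space(2)[OF f]
  have "(cancel_r W D \<circ> tmap V C W D f p) t = (f \<circ> cancel_r V C) t"
    by (rule tensor_eqI[OF lmap_comp[OF lmap_cancel_r[OF W D] lmap_tmap[OF f p]]
          lmap_comp[OF f lmap_cancel_r[OF V C]] t])
      (simp add: tmap_tens[OF f p] cancel_r_tens[OF V C] cancel_r_tens[OF W D] lmap_in[OF f]
        lmap_in[OF p] e lmap_scale[OF f])
  then show ?thesis by simp
qed

lemma cancel_l_natural:
  assumes f: "lmap V W f" and C: "coalgebra C" and D: "coalgebra D" and p: "lmap C D p"
    and e: "\<And>c. c \<in> vecs C \<Longrightarrow> counit D (p c) = counit C c" and t: "t \<in> vecs (C \<otimes> V)"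
  shows "cancel_l D W (tmap C V D W p f t) = f (cancel_l C V t)"
proof -
  note V = lmap_vec_space(1)[OF f] and W = lmap_vec_space(2)[OF f]
  have "(cancel_l D W \<circ> tmap C V D W p f) t = (f \<circ> cancel_l C V) t"
    by (rule tensor_eqI[OF lmap_comp[OF lmap_cancel_l[OF W D] lmap_tmap[OF p f]]
          lmap_comp[OF f lmap_cancel_l[OF V C]] t])
      (simp add: tmap_tens[OF p f] cancel_l_tens[OF V C] cancel_l_tens[OF W D] lmap_in[OF f]
        lmap_in[OF p] e lmap_scale[OF f])
  then show ?thesis by simp
qed

lemma cancel_r_assoc:
  assumes V: "vec_space V" and C: "vec_space C" and D: "coalgebra D"
    and t: "t \<in> vecs (V \<otimes> (C \<otimes> D))"
  shows "cancel_r (V \<otimes> C) D (assoc_l V C D t) = tmap V (C \<otimes> D) V C id (cancel_r C D) t"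
proof -
  note D' = coalgebra_vec_space[OF D] and i = lmap_id[OF V] and c = lmap_cancel_r[OF C D]
  have "(cancel_r (V \<otimes> C) D \<circ> assoc_l V C D) t = tmap V (C \<otimes> D) V C id (cancel_r C D) t"
    by (rule tensor3_eqI[OF lmap_comp[OF lmap_cancel_r[OF vec_space_tensor D]
            lmap_assoc_l[OF V C D']] lmap_tmap[OF i c] t V])
      (simp add: assoc_l_tens[OF V C D'] cancel_r_tens[OF vec_space_tensor D] tens_in[OF V C]
        tens_in[OF C D'] cancel_r_tens[OF C D] tmap_tens[OF i c]
        lmap_scale[OF lmap_tens_right[OF V C]])
  then show ?thesis by simp
qed

text \<open>
  The scalar \<open>\<epsilon>(c)\<close> of \<open>v \<otimes> (c \<otimes> w)\<close> may be given to either neighbour, because the tensor product is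
  balanced over scalars.
\<close>

lemma cancel_middle:
  assumes V: "vec_space V" and W: "vec_space W" and C: "coalgebra C"
    and t: "t \<in> vecs (V \<otimes> (C \<otimes> W))"
  shows "tmap (V \<otimes> C) W V W (cancel_r V C) id (assoc_l V C W t) =
    tmap V (C \<otimes> W) V W id (cancel_l C W) t"
proof -
  note C' = coalgebra_vec_space[OF C] and i = lmap_id[OF V] and j = lmap_id[OF W]
    and r = lmap_cancel_r[OF V C] and l = lmap_cancel_l[OF W C]
  have "(tmap (V \<otimes> C) W V W (cancel_r V C) id \<circ> assoc_l V C W) t =
      tmap V (C \<otimes> W) V W id (cancel_l C W) t"
    by (rule tensor3_eqI[OF lmap_comp[OF lmap_tmap[OF r j] lmap_assoc_l[OF V C' W]]
          lmap_tmap[OF i l] t V])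
      (simp add: assoc_l_tens[OF V C' W] tens_in[OF V C'] tens_in[OF C' W] tmap_tens[OF i l]
        tmap_tens[OF r j] cancel_r_tens[OF V C] cancel_l_tens[OF W C]
        lmap_scale[OF lmap_tens_right[OF V W]] lmap_scale[OF lmap_tens_left[OF V W]])
  then show ?thesis by simp
qed

definition cohom :: "('k::field, 'a::ab_group_add, 'y) coalg_scheme \<Rightarrow>
    ('k, 'c::ab_group_add, 'z) coalg_scheme \<Rightarrow> ('a \<Rightarrow> 'c) \<Rightarrow> bool" where
  "cohom X Y p \<longleftrightarrow> coalgebra X \<and> coalgebra Y \<and> coalgebra_hom X Y p"

lemma
  assumes "cohom X Y p"
  shows cohom_coalgebra: "coalgebra X" "coalgebra Y"
    and cohom_vec_space: "vec_space X" "vec_space Y"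
    and cohom_lmap: "lmap X Y p"
    and cohom_comult: "x \<in> vecs X \<Longrightarrow> comult Y (p x) = tmap X X Y Y p p (comult X x)"
    and cohom_counit: "x \<in> vecs X \<Longrightarrow> counit Y (p x) = counit X x"
  using assms by (auto simp: cohom_def coalgebra_hom_def lmap_def coalgebra_vec_space)

lemma cohom_id:
  assumes X: "coalgebra X"
  shows "cohom X X id"
  using X lmap_id[OF coalgebra_vec_space[OF X]]
    tmap_id[OF coalgebra_vec_space[OF X] coalgebra_vec_space[OF X] lmap_in[OF lmap_comult[OF X]]]
  by (auto simp: cohom_def coalgebra_hom_def lmap_def)

lemma cohom_comp:
  assumes p: "cohom X Y p" and q: "cohom Y Z q"
  shows "cohom X Z (q \<circ> p)"
proof -
  note pl = cohom_lmap[OF p] and ql = cohom_lmap[OF q]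
  have "comult Z (q (p x)) = tmap X X Z Z (q \<circ> p) (q \<circ> p) (comult X x)" if "x \<in> vecs X" for x
    using that lmap_in[OF pl that] lmap_in[OF lmap_comult[OF cohom_coalgebra(1)[OF p]] that]
    by (simp add: cohom_comult[OF q] cohom_comult[OF p] tmap_comp[OF pl pl ql ql])
  then show ?thesis
    using lmap_comp[OF ql pl] p q cohom_counit[OF p] cohom_counit[OF q] lmap_in[OF pl]
    by (auto simp: cohom_def coalgebra_hom_def lmap_def)
qed

lemma
  assumes p: "cohom X Y p"
  shows lmap_L_coact: "lmap X (Y \<otimes> X) (L_coact X Y p)"
    and cancel_l_L_coact: "x \<in> vecs X \<Longrightarrow> cancel_l Y X (L_coact X Y p x) = x"
    and cancel_r_L_coact: "x \<in> vecs X \<Longrightarrow> cancel_r Y X (L_coact X Y p x) = p x"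
proof -
  note X = cohom_coalgebra(1)[OF p] and Y = cohom_coalgebra(2)[OF p] and pl = cohom_lmap[OF p]
  note d = lmap_comult[OF X] and i = lmap_id[OF coalgebra_vec_space[OF X]]
  show "lmap X (Y \<otimes> X) (L_coact X Y p)"
    using lmap_comp[OF lmap_tmap[OF pl i] d] by (simp add: L_coact_def[abs_def] o_def)
  show "x \<in> vecs X \<Longrightarrow> cancel_l Y X (L_coact X Y p x) = x"
    using cancel_l_natural[OF i X Y pl cohom_counit[OF p] lmap_in[OF d]]
    by (simp add: L_coact_def counit_l[OF X])
  show "x \<in> vecs X \<Longrightarrow> cancel_r Y X (L_coact X Y p x) = p x"
    using cancel_r_natural[OF pl X X i _ lmap_in[OF d]]
    by (simp add: L_coact_def counit_r[OF X])
qed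

lemma L_coact_id: "coalgebra X \<Longrightarrow> x \<in> vecs X \<Longrightarrow> L_coact X X id x = comult X x"
  unfolding L_coact_def
  by (rule tmap_id) (auto intro: coalgebra_vec_space lmap_in[OF lmap_comult])

lemma L_coact_comp:
  assumes p: "cohom X Y p" and q: "cohom Y Z q" and x: "x \<in> vecs X"
  shows "L_coact X Z (q \<circ> p) x = tmap Y X Z X q id (L_coact X Y p x)"
proof -
  note i = lmap_id[OF cohom_vec_space(1)[OF p]]
  show ?thesis
    unfolding L_coact_def
    using tmap_comp[OF cohom_lmap[OF p] i cohom_lmap[OF q] i
        lmap_in[OF lmap_comult[OF cohom_coalgebra(1)[OF p]] x]] by simp
qed

text \<open>
  Coassociativity of \<open>G\<close> pushed forward: both sides are
  \<open>(q(r(g\<^sub>1)) \<otimes> r(g\<^sub>2)) \<otimes> g\<^sub>3\<close>, the left one because \<open>r\<close> is compatible with the coproducts.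
\<close>

lemma L_coact_coassoc:
  assumes r: "cohom G K r" and q: "cohom K H q" and g: "g \<in> vecs G"
  shows "tmap K G (H \<otimes> K) G (L_coact K H q) id (L_coact G K r g) =
    assoc_l H K G (tmap H G H (K \<otimes> G) id (L_coact G K r) (L_coact G H (q \<circ> r) g))"
proof -
  note G = cohom_coalgebra(1)[OF r] and K = cohom_coalgebra(2)[OF r]
  note s = coalgebra_vec_space[OF G] cohom_vec_space(2)[OF r] cohom_vec_space(2)[OF q]
  note i = lmap_id[OF s(1)] lmap_id[OF s(2)] lmap_id[OF s(3)]
  note d = lmap_comult[OF G] and dg = lmap_in[OF d g]
  note rl = cohom_lmap[OF r] and ql = cohom_lmap[OF q] and qr = lmap_comp[OF ql rl]
  note Lr = lmap_L_coact[OF r] and Lq = lmap_L_coact[OF q]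
  note ri = lmap_tmap[OF rl i(1)] and qrr = lmap_tmap[OF qr rl]
  have Lqr: "(L_coact K H q \<circ> r) x = (tmap G G H K (q \<circ> r) r \<circ> comult G) x" if x: "x \<in> vecs G" for x
    using tmap_comp[OF rl rl ql i(2) lmap_in[OF d x]] by (simp add: L_coact_def cohom_comult[OF r x])
  have "tmap K G (H \<otimes> K) G (L_coact K H q) id (L_coact G K r g) =
      tmap G G (H \<otimes> K) G (L_coact K H q \<circ> r) id (comult G g)"
    using tmap_comp[OF rl i(1) Lq i(1) dg] by (simp add: L_coact_def[of G])
  also have "\<dots> = tmap G G (H \<otimes> K) G (tmap G G H K (q \<circ> r) r \<circ> comult G) id (comult G g)"
    by (rule tmap_cong[OF lmap_comp[OF qrr d] i(1) dg Lqr]) auto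
  also have "\<dots> = tmap (G \<otimes> G) G (H \<otimes> K) G (tmap G G H K (q \<circ> r) r) id
      (assoc_l G G G (tmap G G G (G \<otimes> G) id (comult G) (comult G g)))"
    using tmap_comp[OF d i(1) qrr i(1) dg] by (simp add: coassoc[OF G g])
  also have "\<dots> = assoc_l H K G (tmap G (G \<otimes> G) H (K \<otimes> G) (q \<circ> r) (tmap G G K G r id)
      (tmap G G G (G \<otimes> G) id (comult G) (comult G g)))"
    by (rule assoc_l_natural[OF qr rl i(1) tmap_in[OF i(1) d dg], symmetric])
  also have "tmap G (G \<otimes> G) H (K \<otimes> G) (q \<circ> r) (tmap G G K G r id)
      (tmap G G G (G \<otimes> G) id (comult G) (comult G g)) =
    tmap G G H (K \<otimes> G) (q \<circ> r) (L_coact G K r) (comult G g)"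
    using tmap_comp[OF i(1) d qr ri dg] by (simp add: L_coact_def[abs_def] o_def)
  also have "\<dots> = tmap H G H (K \<otimes> G) id (L_coact G K r) (L_coact G H (q \<circ> r) g)"
    using tmap_comp[OF qr i(1) i(3) Lr dg] by (simp add: L_coact_def[of G H])
  finally show ?thesis .
qed

text \<open>
  The map \<open>v \<otimes> x \<mapsto> (v \<otimes> p(x\<^sub>1)) \<otimes> x\<^sub>2\<close>. For \<open>p = id\<close> it is the coaction of \<open>X\<close> on \<open>V \<otimes> X\<close> through the
  second factor.
\<close>

definition stretch :: "('k::field, 'v::ab_group_add, 'z) vspace_scheme \<Rightarrow>
    ('k, 'x::ab_group_add, 'y) coalg_scheme \<Rightarrow> ('k, 'c::ab_group_add, 'u) coalg_scheme \<Rightarrow>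
    ('x \<Rightarrow> 'c) \<Rightarrow> ('v, 'x, 'k) tensor \<Rightarrow> (('v, 'c, 'k) tensor, 'x, 'k) tensor" where
  "stretch V X Y p F = assoc_l V Y X (tmap V X V (Y \<otimes> X) id (L_coact X Y p) F)"

lemma lmap_stretch:
  assumes V: "vec_space V" and p: "cohom X Y p"
  shows "lmap (V \<otimes> X) ((V \<otimes> Y) \<otimes> X) (stretch V X Y p)"
  using lmap_comp[OF lmap_assoc_l[OF V cohom_vec_space(2,1)[OF p]]
      lmap_tmap[OF lmap_id[OF V] lmap_L_coact[OF p]]]
  by (simp add: stretch_def[abs_def] o_def)

lemma stretch_subsp:
  assumes M: "subsp M A" and p: "cohom X Y p" and F: "F \<in> vecs (M \<otimes> X)"
  shows "stretch M X Y p F = stretch A X Y p F"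
proof -
  note s = subsp_refl[OF cohom_vec_space(1)[OF p]] subsp_refl[OF cohom_vec_space(2)[OF p]]
  note L = lmap_L_coact[OF p] and i = lmap_id[OF subsp_vec_space(1)[OF M]]
  have i': "lmap M A id" by (rule lmap_restrict[OF M lmap_id[OF subsp_vec_space(2)[OF M]]])
  have "tmap M X M (Y \<otimes> X) id (L_coact X Y p) F = tmap M X A (Y \<otimes> X) id (L_coact X Y p) F"
    by (rule tmap_subsp_target[OF M subsp_refl[OF vec_space_tensor] i L F])
  also have "\<dots> = tmap A X A (Y \<otimes> X) id (L_coact X Y p) F"
    by (rule tmap_subsp_source[OF M s(1) lmap_id[OF subsp_vec_space(2)[OF M]] L F])
  finally show ?thesis
    unfolding stretch_def using assoc_l_subsp[OF M s(2,1) tmap_in[OF i L F]] by simp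
qed

lemma stretch_natural:
  assumes f: "lmap V W f" and p: "cohom X Y p" and F: "F \<in> vecs (V \<otimes> X)"
  shows "stretch W X Y p (tmap V X W X f id F) =
    tmap (V \<otimes> Y) X (W \<otimes> Y) X (tmap V Y W Y f id) id (stretch V X Y p F)"
proof -
  note i = lmap_id[OF cohom_vec_space(1)[OF p]] lmap_id[OF cohom_vec_space(2)[OF p]]
    lmap_id[OF lmap_vec_space(1)[OF f]] lmap_id[OF lmap_vec_space(2)[OF f]]
  note L = lmap_L_coact[OF p] and ii = lmap_tmap[OF i(2,1)]
  have "tmap W X W (Y \<otimes> X) id (L_coact X Y p) (tmap V X W X f id F) =
      tmap V X W (Y \<otimes> X) f (L_coact X Y p) F"
    using tmap_comp[OF f i(1) i(4) L F] by simp
  also have "\<dots> = tmap V X W (Y \<otimes> X) f (tmap Y X Y X id id \<circ> L_coact X Y p) F"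
    by (rule tmap_cong[OF f lmap_comp[OF ii L] F])
      (simp_all add: tmap_id[OF cohom_vec_space(2,1)[OF p]] lmap_in[OF L])
  also have "\<dots> = tmap V (Y \<otimes> X) W (Y \<otimes> X) f (tmap Y X Y X id id)
      (tmap V X V (Y \<otimes> X) id (L_coact X Y p) F)"
    using tmap_comp[OF i(3) L f ii F] by simp
  finally show ?thesis
    unfolding stretch_def using assoc_l_natural[OF f i(2,1) tmap_in[OF i(3) L F]] by simp
qed

lemma stretch_comp:
  assumes V: "vec_space V" and p: "cohom X Y p" and q: "cohom Y Z q" and F: "F \<in> vecs (V \<otimes> X)"
  shows "stretch V X Z (q \<circ> p) F =
    tmap (V \<otimes> Y) X (V \<otimes> Z) X (tmap V Y V Z id q) id (stretch V X Y p F)"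
proof -
  note i = lmap_id[OF V] lmap_id[OF cohom_vec_space(1)[OF p]]
  note L = lmap_L_coact[OF p] and ql = cohom_lmap[OF q] and qi = lmap_tmap[OF cohom_lmap[OF q] i(2)]
  have "tmap V X V (Z \<otimes> X) id (L_coact X Z (q \<circ> p)) F =
      tmap V X V (Z \<otimes> X) id (tmap Y X Z X q id \<circ> L_coact X Y p) F"
    by (rule tmap_cong[OF i(1) lmap_comp[OF qi L] F]) (simp_all add: L_coact_comp[OF p q])
  also have "\<dots> = tmap V (Y \<otimes> X) V (Z \<otimes> X) id (tmap Y X Z X q id)
      (tmap V X V (Y \<otimes> X) id (L_coact X Y p) F)"
    using tmap_comp[OF i(1) L i(1) qi F] by simp
  finally show ?thesis
    unfolding stretch_def using assoc_l_natural[OF i(1) ql i(2) tmap_in[OF i(1) L F]] by simp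
qed

text \<open>
  Both sides are \<open>((v \<otimes> q(r(g\<^sub>1))) \<otimes> r(g\<^sub>2)) \<otimes> g\<^sub>3\<close>. The proof moves the coactions past the associators
  by naturality, applies \<open>L_coact_coassoc\<close> inside \<open>V \<otimes> _\<close>, and rebrackets by the pentagon.
\<close>

lemma stretch_stretch:
  assumes V: "vec_space V" and r: "cohom G K r" and q: "cohom K H q" and F: "F \<in> vecs (V \<otimes> G)"
  shows "tmap (V \<otimes> K) G ((V \<otimes> H) \<otimes> K) G (stretch V K H q) id (stretch V G K r F) =
    stretch (V \<otimes> H) G K r (stretch V G H (q \<circ> r) F)"
proof -
  note qr = cohom_comp[OF r q] and vt = vec_space_tensor
  note s = cohom_vec_space(1)[OF r] cohom_vec_space(2)[OF r] cohom_vec_space(2)[OF q]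
  note i = lmap_id[OF s(1)] lmap_id[OF V] lmap_id[OF s(3)] lmap_id[OF vt[of V H]]
  note Lr = lmap_L_coact[OF r] and Lq = lmap_L_coact[OF q] and Lqr = lmap_L_coact[OF qr]
  note Fr = tmap_in[OF i(2) Lr F] and Fqr = tmap_in[OF i(2) Lqr F]
  note a = lmap_assoc_l[OF V s(3,2)] and aF = lmap_in[OF lmap_assoc_l[OF V s(2,1)] Fr]
  note Lqi = lmap_tmap[OF Lq i(1)] and iLr = lmap_tmap[OF i(3) Lr] and a' = lmap_assoc_l[OF s(3,2,1)]
  have st: "stretch V K H q = assoc_l V H K \<circ> tmap V K V (H \<otimes> K) id (L_coact K H q)"
    by (simp add: fun_eq_iff stretch_def)
  have "tmap (V \<otimes> K) G ((V \<otimes> H) \<otimes> K) G (stretch V K H q) id (stretch V G K r F) =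
      tmap (V \<otimes> (H \<otimes> K)) G ((V \<otimes> H) \<otimes> K) G (assoc_l V H K) id
        (tmap (V \<otimes> K) G (V \<otimes> (H \<otimes> K)) G (tmap V K V (H \<otimes> K) id (L_coact K H q)) id
          (assoc_l V K G (tmap V G V (K \<otimes> G) id (L_coact G K r) F)))"
    using tmap_comp[OF lmap_tmap[OF i(2) Lq] i(1) a i(1) aF]
    by (simp add: st stretch_def[of V G K])
  also have "tmap (V \<otimes> K) G (V \<otimes> (H \<otimes> K)) G (tmap V K V (H \<otimes> K) id (L_coact K H q)) id
          (assoc_l V K G (tmap V G V (K \<otimes> G) id (L_coact G K r) F)) =
      assoc_l V (H \<otimes> K) G (tmap V (K \<otimes> G) V ((H \<otimes> K) \<otimes> G) id (tmap K G (H \<otimes> K) G (L_coact K H q) id)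
        (tmap V G V (K \<otimes> G) id (L_coact G K r) F))"
    by (rule assoc_l_natural[OF i(2) Lq i(1) Fr, symmetric])
  also have "tmap V (K \<otimes> G) V ((H \<otimes> K) \<otimes> G) id (tmap K G (H \<otimes> K) G (L_coact K H q) id)
        (tmap V G V (K \<otimes> G) id (L_coact G K r) F) =
      tmap V G V ((H \<otimes> K) \<otimes> G) id (tmap K G (H \<otimes> K) G (L_coact K H q) id \<circ> L_coact G K r) F"
    using tmap_comp[OF i(2) Lr i(2) Lqi F] by simp
  also have "\<dots> = tmap V G V ((H \<otimes> K) \<otimes> G) id
      (assoc_l H K G \<circ> (tmap H G H (K \<otimes> G) id (L_coact G K r) \<circ> L_coact G H (q \<circ> r))) F"
    by (rule tmap_cong[OF i(2) lmap_comp[OF a' lmap_comp[OF iLr Lqr]] F])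
      (simp_all add: L_coact_coassoc[OF r q])
  also have "\<dots> = tmap V (H \<otimes> (K \<otimes> G)) V ((H \<otimes> K) \<otimes> G) id (assoc_l H K G)
      (tmap V (H \<otimes> G) V (H \<otimes> (K \<otimes> G)) id (tmap H G H (K \<otimes> G) id (L_coact G K r))
        (tmap V G V (H \<otimes> G) id (L_coact G H (q \<circ> r)) F))"
    using tmap_comp[OF i(2) lmap_comp[OF iLr Lqr] i(2) a' F] tmap_comp[OF i(2) Lqr i(2) iLr F] by simp
  also have "tmap (V \<otimes> (H \<otimes> K)) G ((V \<otimes> H) \<otimes> K) G (assoc_l V H K) id (assoc_l V (H \<otimes> K) G \<dots>) =
      assoc_l (V \<otimes> H) K G (assoc_l V H (K \<otimes> G)
        (tmap V (H \<otimes> G) V (H \<otimes> (K \<otimes> G)) id (tmap H G H (K \<otimes> G) id (L_coact G K r))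
          (tmap V G V (H \<otimes> G) id (L_coact G H (q \<circ> r)) F)))"
    by (rule assoc_l_pentagon[OF V s(3,2,1) tmap_in[OF i(2) iLr Fqr]])
  also have "assoc_l V H (K \<otimes> G)
        (tmap V (H \<otimes> G) V (H \<otimes> (K \<otimes> G)) id (tmap H G H (K \<otimes> G) id (L_coact G K r))
          (tmap V G V (H \<otimes> G) id (L_coact G H (q \<circ> r)) F)) =
      tmap (V \<otimes> H) G (V \<otimes> H) (K \<otimes> G) (tmap V H V H id id) (L_coact G K r)
        (stretch V G H (q \<circ> r) F)"
    unfolding stretch_def by (rule assoc_l_natural[OF i(2,3) Lr Fqr])
  also have "\<dots> = tmap (V \<otimes> H) G (V \<otimes> H) (K \<otimes> G) id (L_coact G K r) (stretch V G H (q \<circ> r) F)"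
    by (rule tmap_cong[OF i(4) Lr lmap_in[OF lmap_stretch[OF V qr] F]])
      (simp_all add: tmap_id[OF V s(3)])
  finally show ?thesis unfolding stretch_def[of "V \<otimes> H"] .
qed

text \<open>
  The two counit laws: \<open>\<epsilon>(p(g\<^sub>1)) g\<^sub>2 = g\<close> since \<open>p\<close> preserves counits, and \<open>p(g\<^sub>1) \<epsilon>(g\<^sub>2) = p(g)\<close>.
\<close>

lemma stretch_cancel_inner:
  assumes V: "vec_space V" and p: "cohom G K p" and F: "F \<in> vecs (V \<otimes> G)"
  shows "tmap (V \<otimes> K) G V G (cancel_r V K) id (stretch V G K p F) = F"
proof -
  note s = cohom_vec_space(1)[OF p] cohom_vec_space(2)[OF p] and K = cohom_coalgebra(2)[OF p]
  note i = lmap_id[OF V] lmap_id[OF s(1)] and L = lmap_L_coact[OF p] and c = lmap_cancel_l[OF s(1) K]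
  have "tmap (V \<otimes> K) G V G (cancel_r V K) id (stretch V G K p F) =
      tmap V (K \<otimes> G) V G id (cancel_l K G) (tmap V G V (K \<otimes> G) id (L_coact G K p) F)"
    unfolding stretch_def by (rule cancel_middle[OF V s(1) K tmap_in[OF i(1) L F]])
  also have "\<dots> = tmap V G V G id (cancel_l K G \<circ> L_coact G K p) F"
    using tmap_comp[OF i(1) L i(1) c F] by simp
  also have "\<dots> = tmap V G V G id id F"
    by (rule tmap_cong[OF i F]) (simp_all add: cancel_l_L_coact[OF p])
  finally show ?thesis by (simp add: tmap_id[OF V s(1) F])
qed

lemma stretch_cancel_outer:
  assumes V: "vec_space V" and p: "cohom G K p" and F: "F \<in> vecs (V \<otimes> G)"
  shows "cancel_r (V \<otimes> K) G (stretch V G K p F) = tmap V G V K id p F"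
proof -
  note s = cohom_vec_space(1)[OF p] cohom_vec_space(2)[OF p] and G = cohom_coalgebra(1)[OF p]
  note i = lmap_id[OF V] and L = lmap_L_coact[OF p] and c = lmap_cancel_r[OF s(2) G]
  have "cancel_r (V \<otimes> K) G (stretch V G K p F) =
      tmap V (K \<otimes> G) V K id (cancel_r K G) (tmap V G V (K \<otimes> G) id (L_coact G K p) F)"
    unfolding stretch_def by (rule cancel_r_assoc[OF V s(2) G tmap_in[OF i L F]])
  also have "\<dots> = tmap V G V K id (cancel_r K G \<circ> L_coact G K p) F"
    using tmap_comp[OF i L i c F] by simp
  also have "\<dots> = tmap V G V K id p F"
    by (rule tmap_cong[OF i cohom_lmap[OF p] F]) (simp_all add: cancel_r_L_coact[OF p])
  finally show ?thesis .
qed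

section \<open>Corepresentations and their equivalences\<close>

lemma stretch_id:
  assumes V: "vec_space V" and X: "coalgebra X" and F: "F \<in> vecs (V \<otimes> X)"
  shows "stretch V X X id F = assoc_l V X X (tmap V X V (X \<otimes> X) id (comult X) F)"
  unfolding stretch_def
  using tmap_cong[OF lmap_id[OF V] lmap_comult[OF X] F _ L_coact_id[OF X]] by simp

text \<open>
  Coassociativity of a coaction says that the coaction takes its values in the equaliser that defines
  the corepresentation induced along the identity.
\<close>

lemma right_corep_iff:
  assumes C: "coalgebra C"
  shows "right_corep C V \<longleftrightarrow> lmap V (V \<otimes> C) (coact V) \<and>
    (\<forall>v\<in>vecs V. tmap V C (V \<otimes> C) C (coact V) id (coact V v) = stretch V C C id (coact V v)) \<and>
    (\<forall>v\<in>vecs V. cancel_r V C (coact V v) = v)"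
  using stretch_id[OF _ C, of V] lmap_in[of V "V \<otimes> C" "coact V"]
  unfolding right_corep_def cancel_r_def[symmetric] lmap_def
  by (auto simp: vec_space_tensor)

lemma
  assumes "right_corep C V"
  shows right_corep_vec_space: "vec_space V"
    and lmap_coact: "lmap V (V \<otimes> C) (coact V)"
  using assms by (auto simp: right_corep_def lmap_def vec_space_tensor)

text \<open>
  A coaction that corresponds to that of \<open>V\<close> under a linear isomorphism inherits linearity,
  coassociativity and counitality, so an equivalence need not be accompanied by a separate proof that
  its target is a corepresentation.
\<close>

lemma right_corep_transport:
  assumes C: "coalgebra C" and V: "right_corep C V" and f: "lmap V W f" and g: "lmap W V g"
    and gf: "\<And>v. v \<in> vecs V \<Longrightarrow> g (f v) = v" and fg: "\<And>w. w \<in> vecs W \<Longrightarrow> f (g w) = w"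
    and co: "\<And>v. v \<in> vecs V \<Longrightarrow> coact W (f v) = tmap V C W C f id (coact V v)"
  shows "right_corep C W"
proof -
  note i = lmap_id[OF coalgebra_vec_space[OF C]] and r = lmap_coact[OF V] and c = cohom_id[OF C]
  have V': "tmap V C (V \<otimes> C) C (coact V) id (coact V v) = stretch V C C id (coact V v)"
    "cancel_r V C (coact V v) = v" if "v \<in> vecs V" for v
    using V that by (auto simp: right_corep_iff[OF C])
  have l: "lmap W (W \<otimes> C) (coact W)"
    using lmap_cong[OF lmap_comp[OF lmap_tmap[OF f i] lmap_comp[OF r g]], of "coact W"]
      co[OF lmap_in[OF g]] fg by simp
  have "tmap W C (W \<otimes> C) C (coact W) id (coact W (f v)) = stretch W C C id (coact W (f v))"
    and "cancel_r W C (coact W (f v)) = f v" if v: "v \<in> vecs V" for v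
  proof -
    note rv = lmap_in[OF r v]
    have "tmap W C (W \<otimes> C) C (coact W) id (coact W (f v)) =
        tmap V C (W \<otimes> C) C (coact W \<circ> f) id (coact V v)"
      using tmap_comp[OF f i l i rv] by (simp add: co[OF v])
    also have "\<dots> = tmap V C (W \<otimes> C) C (tmap V C W C f id \<circ> coact V) id (coact V v)"
      by (rule tmap_cong[OF lmap_comp[OF lmap_tmap[OF f i] r] i rv]) (simp_all add: co)
    also have "\<dots> = tmap (V \<otimes> C) C (W \<otimes> C) C (tmap V C W C f id) id (stretch V C C id (coact V v))"
      using tmap_comp[OF r i lmap_tmap[OF f i] i rv] by (simp add: V'(1)[OF v])
    also have "\<dots> = stretch W C C id (coact W (f v))"
      using stretch_natural[OF f c rv] by (simp add: co[OF v])
    finally show "tmap W C (W \<otimes> C) C (coact W) id (coact W (f v)) = stretch W C C id (coact W (f v))" .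
    show "cancel_r W C (coact W (f v)) = f v"
      using cancel_r_natural[OF f C C i _ rv] by (simp add: co[OF v] V'(2)[OF v])
  qed
  from this[OF lmap_in[OF g]] show ?thesis
    unfolding right_corep_iff[OF C] using l by (simp add: fg)
qed

lemma right_corep_equivI:
  assumes C: "coalgebra C" and V: "right_corep C V" and f: "lmap V W f" and g: "lmap W V g"
    and gf: "\<And>v. v \<in> vecs V \<Longrightarrow> g (f v) = v" and fg: "\<And>w. w \<in> vecs W \<Longrightarrow> f (g w) = w"
    and co: "\<And>v. v \<in> vecs V \<Longrightarrow> coact W (f v) = tmap V C W C f id (coact V v)"
  shows "right_corep_equiv C V W"
proof -
  have "bij_betw f (vecs V) (vecs W)"
    by (rule bij_betw_byWitness[of _ g]) (use gf fg lmap_in[OF f] lmap_in[OF g] in auto)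
  then show ?thesis
    using f co V right_corep_transport[OF C V f g gf fg co]
    unfolding right_corep_equiv_def lmap_def by blast
qed

text \<open>
  An equivalence together with its inverse. Keeping the two symmetric makes symmetry of the
  equivalence relation, and its preservation by induction, immediate from the data.
\<close>

definition corep_iso :: "('k::field, 'c::ab_group_add, 'z) coalg_scheme \<Rightarrow>
    ('k, 'v::ab_group_add, 'c) rcorep \<Rightarrow> ('k, 'w::ab_group_add, 'c) rcorep \<Rightarrow>
    ('v \<Rightarrow> 'w) \<Rightarrow> ('w \<Rightarrow> 'v) \<Rightarrow> bool" where
  "corep_iso C V W f g \<longleftrightarrow> lmap V W f \<and> lmap W V g \<and>
     (\<forall>v\<in>vecs V. g (f v) = v) \<and> (\<forall>w\<in>vecs W. f (g w) = w) \<and>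
     (\<forall>v\<in>vecs V. coact W (f v) = tmap V C W C f id (coact V v)) \<and>
     (\<forall>w\<in>vecs W. coact V (g w) = tmap W C V C g id (coact W w))"

lemma corep_isoD:
  assumes "corep_iso C V W f g"
  shows "lmap V W f" "lmap W V g"
    and "v \<in> vecs V \<Longrightarrow> g (f v) = v" "w \<in> vecs W \<Longrightarrow> f (g w) = w"
    and "v \<in> vecs V \<Longrightarrow> coact W (f v) = tmap V C W C f id (coact V v)"
    and "w \<in> vecs W \<Longrightarrow> coact V (g w) = tmap W C V C g id (coact W w)"
  using assms by (simp_all add: corep_iso_def)

lemma right_corep_equiv_imp_iso:
  assumes C: "coalgebra C" and e: "right_corep_equiv C V W"
  shows "\<exists>f g. corep_iso C V W f g"
proof -
  have V: "right_corep C V" and W: "right_corep C W"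
    using e by (auto simp: right_corep_equiv_def)
  note i = lmap_id[OF coalgebra_vec_space[OF C]]
  note s = right_corep_vec_space[OF V] right_corep_vec_space[OF W]
  obtain f where f': "lin V W f" and b: "bij_betw f (vecs V) (vecs W)"
    and co: "\<And>v. v \<in> vecs V \<Longrightarrow> coact W (f v) = tmap V C W C f id (coact V v)"
    using e by (auto simp: right_corep_equiv_def)
  have f: "lmap V W f" using f' s by (simp add: lmap_def)
  define g where "g = inv_into (vecs V) f"
  have gf: "g (f v) = v" if "v \<in> vecs V" for v
    unfolding g_def using b that by (simp add: bij_betw_inv_into_left)
  have fg: "f (g w) = w" if "w \<in> vecs W" for w
    unfolding g_def using b that by (simp add: bij_betw_inv_into_right)
  have gV: "g w \<in> vecs V" if "w \<in> vecs W" for w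
    unfolding g_def using b that by (metis bij_betw_def inv_into_into)
  have g: "lmap W V g"
    unfolding lmap_def lin_def
  proof (intro conjI ballI allI)
    fix x c assume x: "x \<in> vecs W"
    show "g (scl W c x) = scl V c (g x)"
      using gf[OF vecs_scl[OF s(1) gV[OF x]], of c] lmap_scale[OF f gV[OF x]] fg[OF x] by simp
    fix y assume y: "y \<in> vecs W"
    show "g (x + y) = g x + g y"
      using gf[OF vecs_add[OF s(1) gV[OF x] gV[OF y]]] f' gV[OF x] gV[OF y] fg[OF x] fg[OF y]
      by (simp add: lin_def)
  qed (use s gV in auto)
  have "coact V (g w) = tmap W C V C g id (coact W w)" if w: "w \<in> vecs W" for w
  proof -
    note rv = lmap_in[OF lmap_coact[OF V] gV[OF w]]
    have "tmap W C V C g id (coact W (f (g w))) = tmap V C V C (g \<circ> f) id (coact V (g w))"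
      using tmap_comp[OF f i g i rv] by (simp add: co[OF gV[OF w]])
    also have "\<dots> = tmap V C V C id id (coact V (g w))"
      by (rule tmap_cong[OF lmap_id[OF s(1)] i rv]) (simp_all add: gf)
    finally show ?thesis
      by (simp add: fg[OF w] tmap_id[OF s(1) coalgebra_vec_space[OF C] rv])
  qed
  then have "corep_iso C V W f g"
    using f g gf fg co by (simp add: corep_iso_def)
  then show ?thesis by blast
qed

lemma right_corep_equiv_sym:
  assumes C: "coalgebra C" and e: "right_corep_equiv C V W"
  shows "right_corep_equiv C W V"
proof -
  have W: "right_corep C W" using e by (simp add: right_corep_equiv_def)
  obtain f g where "corep_iso C V W f g" using right_corep_equiv_imp_iso[OF C e] by blast
  note i = corep_isoD[OF this]
  show ?thesis by (rule right_corep_equivI[OF C W i(2,1,4,3,6)])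
qed

lemma right_corep_equiv_trans:
  assumes C: "coalgebra C" and e: "right_corep_equiv C U V" and e': "right_corep_equiv C V W"
  shows "right_corep_equiv C U W"
proof -
  have U: "right_corep C U" using e by (simp add: right_corep_equiv_def)
  obtain f g where "corep_iso C U V f g" using right_corep_equiv_imp_iso[OF C e] by blast
  note f = corep_isoD[OF this]
  obtain f' g' where "corep_iso C V W f' g'" using right_corep_equiv_imp_iso[OF C e'] by blast
  note f' = corep_isoD[OF this]
  note i = lmap_id[OF coalgebra_vec_space[OF C]]
  show ?thesis
  proof (rule right_corep_equivI[OF C U lmap_comp[OF f'(1) f(1)] lmap_comp[OF f(2) f'(2)]])
    show "(g \<circ> g') ((f' \<circ> f) u) = u" if "u \<in> vecs U" for u
      using f(3) f'(3) lmap_in[OF f(1)] that by simp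
    show "(f' \<circ> f) ((g \<circ> g') w) = w" if "w \<in> vecs W" for w
      using f(4) f'(4) lmap_in[OF f'(2)] that by simp
    show "coact W ((f' \<circ> f) u) = tmap U C W C (f' \<circ> f) id (coact U u)" if u: "u \<in> vecs U" for u
      using tmap_comp[OF f(1) i f'(1) i lmap_in[OF lmap_coact[OF U] u]]
      by (simp add: f'(5)[OF lmap_in[OF f(1) u]] f(5)[OF u])
  qed
qed

section \<open>Induced right corepresentations\<close>

lemma equalizer_subsp:
  fixes M :: "('k::field, 'v::ab_group_add, 'y) vspace_scheme"
  assumes f: "lmap A B f" and g: "lmap A B g"
    and eq: "vecs M = {a \<in> vecs A. f a = g a}" and s: "scl M = scl A"
  shows "subsp M A"
proof -
  note vs = lmap_vec_space[OF f]
  interpret a: vector_space "scl A" using vs(1) by (simp add: vec_space_def)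
  have "a.subspace (vecs M)"
  proof (rule a.subspaceI)
    show "0 \<in> vecs M"
      using lmap_minus[OF f, of 0 0] lmap_minus[OF g, of 0 0] vecs_0[OF vs(1)] by (simp add: eq)
  qed (use f g vecs_add[OF vs(1)] vecs_scl[OF vs(1)] in \<open>auto simp: eq lmap_def lin_def\<close>)
  then show ?thesis using vs(1) by (auto simp: subsp_def vec_space_def s eq)
qed

lemma vecs_ind_right: "vecs (ind_right X Y p V) =
    {F \<in> vecs (V \<otimes> X). stretch V X Y p F = tmap V X (V \<otimes> Y) X (coact V) id F}"
  by (simp add: ind_right_def stretch_def)

lemma subsp_ind_right:
  assumes p: "cohom X Y p" and V: "right_corep Y V"
  shows "subsp (ind_right X Y p V) (V \<otimes> X)"
  by (rule equalizer_subsp[OF lmap_stretch[OF right_corep_vec_space[OF V] p]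
        lmap_tmap[OF lmap_coact[OF V] lmap_id[OF cohom_vec_space(1)[OF p]]] vecs_ind_right])
    (simp add: ind_right_def)

lemma coact_ind_right:
  assumes p: "cohom X Y p" and V: "right_corep Y V" and F: "F \<in> vecs (ind_right X Y p V)"
  shows "coact (ind_right X Y p V) F = stretch V X X id F"
  using F stretch_id[OF right_corep_vec_space[OF V] cohom_coalgebra(1)[OF p], of F]
  by (simp add: vecs_ind_right) (simp add: ind_right_def)

text \<open>
  The induced space is the equaliser of \<open>stretch V K H q\<close> and \<open>\<rho> \<otimes> id\<close>, so by exactness it suffices
  that these maps, tensored with \<open>G\<close>, agree on \<open>stretch V G K r F\<close>. By \<open>stretch_stretch\<close> and by
  naturality of \<open>stretch\<close> this is the image under \<open>stretch (V \<otimes> H) G K r\<close> of the induction condition on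
  \<open>F\<close>. With \<open>r = id\<close> the lemma says that the induced coaction stays inside the induced space.
\<close>

lemma stretch_in_ind_right_tensor:
  assumes r: "cohom G K r" and q: "cohom K H q" and V: "right_corep H V"
    and F: "F \<in> vecs (ind_right G H (q \<circ> r) V)"
  shows "stretch V G K r F \<in> vecs (ind_right K H q V \<otimes> G)"
proof -
  note s = right_corep_vec_space[OF V] and rho = lmap_coact[OF V]
  note i = lmap_id[OF cohom_vec_space(1)[OF q]]
  have F': "F \<in> vecs (V \<otimes> G)"
    and eq: "stretch V G H (q \<circ> r) F = tmap V G (V \<otimes> H) G (coact V) id F"
    using F by (auto simp: vecs_ind_right)
  show ?thesis
  proof (rule equalizer_tensor[OF lmap_stretch[OF s q] lmap_tmap[OF rho i] cohom_vec_space(1)[OF r]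
        subsp_ind_right[OF q V] vecs_ind_right lmap_in[OF lmap_stretch[OF s r] F']])
    show "tmap (V \<otimes> K) G ((V \<otimes> H) \<otimes> K) G (stretch V K H q) id (stretch V G K r F) =
      tmap (V \<otimes> K) G ((V \<otimes> H) \<otimes> K) G (tmap V K (V \<otimes> H) K (coact V) id) id (stretch V G K r F)"
      by (simp add: stretch_stretch[OF s r q F'] eq stretch_natural[OF rho r F'])
  qed
qed

lemma coact_ind_right_in:
  assumes p: "cohom X Y p" and V: "right_corep Y V" and F: "F \<in> vecs (ind_right X Y p V)"
  shows "coact (ind_right X Y p V) F \<in> vecs (ind_right X Y p V \<otimes> X)"
  using stretch_in_ind_right_tensor[OF cohom_id[OF cohom_coalgebra(1)[OF p]] p V] F
  by (simp add: coact_ind_right[OF p V])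

lemma lmap_coact_ind_right:
  assumes p: "cohom X Y p" and V: "right_corep Y V"
  shows "lmap (ind_right X Y p V) (ind_right X Y p V \<otimes> X) (coact (ind_right X Y p V))"
proof -
  note sub = subsp_ind_right[OF p V] and X = cohom_coalgebra(1)[OF p]
  have "lmap (ind_right X Y p V) ((V \<otimes> X) \<otimes> X) (coact (ind_right X Y p V))"
    by (rule lmap_cong[OF lmap_restrict[OF sub lmap_stretch[OF right_corep_vec_space[OF V] cohom_id[OF X]]]])
      (rule coact_ind_right[OF p V])
  then show ?thesis
    by (rule lmap_corestrict[OF subsp_tensor[OF sub subsp_refl[OF cohom_vec_space(1)[OF p]]]])
      (rule coact_ind_right_in[OF p V])
qed

lemma tmap_coact_ind_right:
  assumes p: "cohom X Y p" and V: "right_corep Y V" and Z: "vec_space Z"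
    and t: "t \<in> vecs (ind_right X Y p V \<otimes> Z)"
  shows "tmap (ind_right X Y p V) Z (ind_right X Y p V \<otimes> X) Z (coact (ind_right X Y p V)) id t =
    tmap (V \<otimes> X) Z ((V \<otimes> X) \<otimes> X) Z (stretch V X X id) id t" (is "tmap ?M _ _ _ _ _ _ = _")
proof -
  note sub = subsp_ind_right[OF p V] and X = cohom_coalgebra(1)[OF p] and i = lmap_id[OF Z]
  note s = lmap_stretch[OF right_corep_vec_space[OF V] cohom_id[OF X]]
  have "tmap ?M Z (?M \<otimes> X) Z (coact ?M) id t = tmap ?M Z ((V \<otimes> X) \<otimes> X) Z (coact ?M) id t"
    by (rule tmap_subsp_target[OF subsp_tensor[OF sub subsp_refl[OF cohom_vec_space(1)[OF p]]]
          subsp_refl[OF Z] lmap_coact_ind_right[OF p V] i t])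
  also have "\<dots> = tmap ?M Z ((V \<otimes> X) \<otimes> X) Z (stretch V X X id) id t"
    by (rule tmap_cong[OF lmap_restrict[OF sub s] i t]) (simp_all add: coact_ind_right[OF p V])
  also have "\<dots> = tmap (V \<otimes> X) Z ((V \<otimes> X) \<otimes> X) Z (stretch V X X id) id t"
    by (rule tmap_subsp_source[OF sub subsp_refl[OF Z] s i t])
  finally show ?thesis .
qed

lemma cancel_r_subsp:
  assumes M: "subsp M A" and C: "coalgebra C" and t: "t \<in> vecs (M \<otimes> C)"
  shows "cancel_r M C t = cancel_r A C t"
proof -
  note s = subsp_vec_space[OF M] and C' = subsp_refl[OF coalgebra_vec_space[OF C]]
  have "scl M = scl A" using M by (simp add: subsp_def)
  then show ?thesis
    using tensor_eqI[OF lmap_extend[OF M lmap_cancel_r[OF s(1) C]]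
        lmap_restrict[OF subsp_tensor[OF M C'] lmap_cancel_r[OF s(2) C]] t]
      cancel_r_tens[OF s(1) C] cancel_r_tens[OF s(2) C] subsp_in[OF M] tens_subsp[OF M C']
    by simp
qed

lemma right_corep_ind_right:
  assumes p: "cohom X Y p" and V: "right_corep Y V"
  shows "right_corep X (ind_right X Y p V)" (is "right_corep X ?M")
proof -
  note X = cohom_coalgebra(1)[OF p] and sub = subsp_ind_right[OF p V]
  note s = right_corep_vec_space[OF V] and c = cohom_id[OF X]
  have "tmap ?M X (?M \<otimes> X) X (coact ?M) id (coact ?M F) = stretch ?M X X id (coact ?M F) \<and>
      cancel_r ?M X (coact ?M F) = F" if F: "F \<in> vecs ?M" for F
  proof -
    have F': "F \<in> vecs (V \<otimes> X)" using subsp_in[OF sub F] .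
    note m = coact_ind_right_in[OF p V F]
    have co: "coact ?M F = stretch V X X id F" by (rule coact_ind_right[OF p V F])
    show ?thesis
      using stretch_stretch[OF s c c F'] stretch_cancel_outer[OF s c F'] m
      by (simp add: tmap_coact_ind_right[OF p V coalgebra_vec_space[OF X] m]
          stretch_subsp[OF sub c m] cancel_r_subsp[OF sub X m])
        (simp add: co tmap_id[OF s coalgebra_vec_space[OF X] F'])
  qed
  then show ?thesis
    using lmap_coact_ind_right[OF p V] by (simp add: right_corep_iff[OF X])
qed

text \<open>
  Apply the counit of \<open>K\<close> to the last factor of the induction condition
  \<open>v \<otimes> q(k\<^sub>1) \<otimes> k\<^sub>2 = v\<^sub>0 \<otimes> v\<^sub>1 \<otimes> k\<close>. The evaluation \<open>cancel_r V K\<close> is the counit of the adjunction between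
  restriction and induction, and the lemma says that it is a map of corepresentations of \<open>H\<close>.
\<close>

lemma coact_cancel_ind_right:
  assumes q: "cohom K H q" and V: "right_corep H V" and m: "m \<in> vecs (ind_right K H q V)"
  shows "coact V (cancel_r V K m) = tmap V K V H id q m"
proof -
  note K = cohom_coalgebra(1)[OF q]
  have m': "m \<in> vecs (V \<otimes> K)"
    and eq: "stretch V K H q m = tmap V K (V \<otimes> H) K (coact V) id m"
    using m by (auto simp: vecs_ind_right)
  have "tmap V K V H id q m = cancel_r (V \<otimes> H) K (tmap V K (V \<otimes> H) K (coact V) id m)"
    using stretch_cancel_outer[OF right_corep_vec_space[OF V] q m'] by (simp add: eq)
  also have "\<dots> = coact V (cancel_r V K m)"
    by (rule cancel_r_natural[OF lmap_coact[OF V] K K lmap_id[OF coalgebra_vec_space[OF K]] _ m']) simp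
  finally show ?thesis by simp
qed

text \<open>
  The equivalence is \<open>stretch V G K p\<close>, with inverse \<open>cancel_r V K \<otimes> id\<close>.
\<close>

theorem ind_right_in_stages:
  assumes p: "cohom G K p" and q: "cohom K H q" and V: "right_corep H V"
  shows "right_corep_equiv G (ind_right G H (q \<circ> p) V) (ind_right G K p (ind_right K H q V))"
proof -
  let ?P = "ind_right G H (q \<circ> p) V" and ?M = "ind_right K H q V"
  let ?N = "ind_right G K p ?M" and ?A = "V \<otimes> K"
  let ?f = "stretch V G K p" and ?g = "tmap ?A G V G (cancel_r V K) id"
  note qp = cohom_comp[OF p q] and V' = right_corep_vec_space[OF V]
  note G = cohom_coalgebra(1)[OF p] and K = cohom_coalgebra(2)[OF p]
  note G' = cohom_vec_space(1)[OF p] and K' = cohom_vec_space(2)[OF p]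
  note cG = cohom_id[OF G] and cK = cohom_id[OF K] and iG = lmap_id[OF G'] and iK = lmap_id[OF K']
  note M = right_corep_ind_right[OF q V]
  note subP = subsp_ind_right[OF qp V] and subM = subsp_ind_right[OF q V]
    and subN = subsp_ind_right[OF p M]
  note subMG = subsp_tensor[OF subM subsp_refl[OF G']]
  have subN': "subsp ?N (?A \<otimes> G)"
    using subN subMG by (auto simp: subsp_def)
  note f = lmap_stretch[OF V' p] and c = lmap_cancel_r[OF V' K] and rho = lmap_coact[OF V]
  note g = lmap_tmap[OF c iG]
  \<comment> \<open>The induction condition from \<open>K\<close> to \<open>G\<close>, read in the ambient space \<open>(V \<otimes> K) \<otimes> G\<close>.\<close>
  have ind_eq: "stretch ?A G K p n = tmap ?A G (?A \<otimes> K) G (stretch V K K id) id n"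
    if n: "n \<in> vecs ?N" for n
  proof -
    have n': "n \<in> vecs (?M \<otimes> G)" using subsp_in[OF subN n] .
    have "stretch ?M G K p n = tmap ?M G (?M \<otimes> K) G (coact ?M) id n"
      using n by (simp add: vecs_ind_right[of G K])
    then show ?thesis
      by (simp add: stretch_subsp[OF subM p n'] tmap_coact_ind_right[OF q V G' n'])
  qed
  \<comment> \<open>\<open>stretch_stretch\<close> with \<open>q = id\<close> is the induction condition for \<open>?f F\<close>.\<close>
  have fN: "?f F \<in> vecs ?N" if F: "F \<in> vecs ?P" for F
  proof -
    have F': "F \<in> vecs (V \<otimes> G)" using subsp_in[OF subP F] .
    note m = stretch_in_ind_right_tensor[OF p q V F]
    have "stretch ?M G K p (?f F) = tmap ?M G (?M \<otimes> K) G (coact ?M) id (?f F)"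
      using stretch_stretch[OF V' p cK F']
      by (simp add: stretch_subsp[OF subM p m] tmap_coact_ind_right[OF q V G' m])
    then show ?thesis using m by (simp add: vecs_ind_right[of G K])
  qed
  have gf: "?g (?f F) = F" if F: "F \<in> vecs ?P" for F
    by (rule stretch_cancel_inner[OF V' p subsp_in[OF subP F]])
  \<comment> \<open>Applying the counit to the inner \<open>K\<close> in the induction condition of \<open>n\<close> gives this equation.\<close>
  have fg: "?f (?g n) = n" if n: "n \<in> vecs ?N" for n
  proof -
    have n': "n \<in> vecs (?A \<otimes> G)" using subsp_in[OF subN' n] .
    note ci = lmap_tmap[OF c iK] and s = lmap_stretch[OF V' cK]
    have "?f (?g n) = tmap (?A \<otimes> K) G ?A G (tmap ?A K V K (cancel_r V K) id) id
        (tmap ?A G (?A \<otimes> K) G (stretch V K K id) id n)"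
      by (simp add: stretch_natural[OF c p n'] ind_eq[OF n])
    also have "\<dots> = tmap ?A G ?A G (tmap ?A K V K (cancel_r V K) id \<circ> stretch V K K id) id n"
      using tmap_comp[OF s iG ci iG n'] by simp
    also have "\<dots> = tmap ?A G ?A G id id n"
      by (rule tmap_cong[OF lmap_id[OF vec_space_tensor] iG n'])
        (simp_all add: stretch_cancel_inner[OF V' cK])
    finally show ?thesis by (simp add: tmap_id[OF vec_space_tensor G' n'])
  qed
  \<comment> \<open>Both sides of the induction condition for \<open>?g n\<close> turn out to be the image of \<open>n\<close> under \<open>(id \<otimes> q) \<otimes> id\<close>.\<close>
  have gP: "?g n \<in> vecs ?P" if n: "n \<in> vecs ?N" for n
  proof -
    have nM: "n \<in> vecs (?M \<otimes> G)" using subsp_in[OF subN n] .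
    have n': "n \<in> vecs (?A \<otimes> G)" using subsp_in[OF subMG nM] .
    note rc = lmap_comp[OF rho c] and iq = lmap_tmap[OF lmap_id[OF V'] cohom_lmap[OF q]]
    have "tmap V G (V \<otimes> H) G (coact V) id (?g n) =
        tmap ?A G (V \<otimes> H) G (coact V \<circ> cancel_r V K) id n"
      using tmap_comp[OF c iG rho iG n'] by simp
    also have "\<dots> = tmap ?M G (V \<otimes> H) G (coact V \<circ> cancel_r V K) id n"
      by (rule tmap_subsp_source[OF subM subsp_refl[OF G'] rc iG nM, symmetric])
    also have "\<dots> = tmap ?M G (V \<otimes> H) G (tmap V K V H id q) id n"
      by (rule tmap_cong[OF lmap_restrict[OF subM iq] iG nM])
        (simp_all add: coact_cancel_ind_right[OF q V])
    also have "\<dots> = tmap ?A G (V \<otimes> H) G (tmap V K V H id q) id (?f (?g n))"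
      by (simp only: tmap_subsp_source[OF subM subsp_refl[OF G'] iq iG nM] fg[OF n])
    also have "\<dots> = stretch V G H (q \<circ> p) (?g n)"
      by (rule stretch_comp[OF V' p q lmap_in[OF g n'], symmetric])
    finally show ?thesis using lmap_in[OF g n'] by (simp add: vecs_ind_right[of G H])
  qed
  have f': "lmap ?P ?N ?f"
    by (rule lmap_corestrict[OF subN' lmap_restrict[OF subP f] fN])
  have g': "lmap ?N ?P ?g"
    by (rule lmap_corestrict[OF subP lmap_restrict[OF subN' g] gP])
  show ?thesis
  proof (rule right_corep_equivI[OF G right_corep_ind_right[OF qp V] f' g'])
    show "?g (?f F) = F" if "F \<in> vecs ?P" for F by (rule gf[OF that])
    show "?f (?g n) = n" if "n \<in> vecs ?N" for n by (rule fg[OF that])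
    fix F assume F: "F \<in> vecs ?P"
    have F': "F \<in> vecs (V \<otimes> G)" using subsp_in[OF subP F] .
    note d = coact_ind_right_in[OF qp V F]
    \<comment> \<open>The intertwining property is \<open>stretch_stretch\<close> with \<open>r = id\<close>.\<close>
    have "tmap ?P G ?N G ?f id (coact ?P F) = tmap ?P G (?A \<otimes> G) G ?f id (coact ?P F)"
      by (rule tmap_subsp_target[OF subN' subsp_refl[OF G'] f' iG d])
    also have "\<dots> = tmap (V \<otimes> G) G (?A \<otimes> G) G ?f id (stretch V G G id F)"
      using tmap_subsp_source[OF subP subsp_refl[OF G'] f iG d] by (simp add: coact_ind_right[OF qp V F])
    also have "\<dots> = stretch ?A G G id (?f F)"
      using stretch_stretch[OF V' cG p F'] by simp
    also have "\<dots> = coact ?N (?f F)"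
      by (simp add: coact_ind_right[OF p M fN[OF F]]
          stretch_subsp[OF subM cG stretch_in_ind_right_tensor[OF p q V F]])
    finally show "coact ?N (?f F) = tmap ?P G ?N G ?f id (coact ?P F)" by simp
  qed
qed

lemma ind_right_map:
  assumes p: "cohom X Y p" and V: "right_corep Y V" and W: "right_corep Y W" and f: "lmap V W f"
    and co: "\<And>v. v \<in> vecs V \<Longrightarrow> coact W (f v) = tmap V Y W Y f id (coact V v)"
    and F: "F \<in> vecs (ind_right X Y p V)"
  shows "tmap V X W X f id F \<in> vecs (ind_right X Y p W)"
proof -
  note i = lmap_id[OF cohom_vec_space(1)[OF p]] and j = lmap_id[OF cohom_vec_space(2)[OF p]]
  note rV = lmap_coact[OF V] and rW = lmap_coact[OF W]
  have F': "F \<in> vecs (V \<otimes> X)"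
    and eq: "stretch V X Y p F = tmap V X (V \<otimes> Y) X (coact V) id F"
    using F by (auto simp: vecs_ind_right)
  have "tmap W X (W \<otimes> Y) X (coact W) id (tmap V X W X f id F) =
      tmap V X (W \<otimes> Y) X (coact W \<circ> f) id F"
    using tmap_comp[OF f i rW i F'] by simp
  also have "\<dots> = tmap V X (W \<otimes> Y) X (tmap V Y W Y f id \<circ> coact V) id F"
    by (rule tmap_cong[OF lmap_comp[OF lmap_tmap[OF f j] rV] i F']) (simp_all add: co)
  also have "\<dots> = tmap (V \<otimes> Y) X (W \<otimes> Y) X (tmap V Y W Y f id) id (stretch V X Y p F)"
    using tmap_comp[OF rV i lmap_tmap[OF f j] i F'] by (simp add: eq)
  also have "\<dots> = stretch W X Y p (tmap V X W X f id F)"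
    by (rule stretch_natural[OF f p F', symmetric])
  finally show ?thesis using tmap_in[OF f i F'] by (simp add: vecs_ind_right)
qed

text \<open>
  Induction is a functor, with \<open>f \<otimes> id\<close> as the map induced by \<open>f\<close>.
\<close>

lemma ind_right_equiv:
  assumes p: "cohom X Y p" and e: "right_corep_equiv Y V W"
  shows "right_corep_equiv X (ind_right X Y p V) (ind_right X Y p W)"
proof -
  note X = cohom_coalgebra(1)[OF p] and Y = cohom_coalgebra(2)[OF p]
  have V: "right_corep Y V" and W: "right_corep Y W"
    using e by (auto simp: right_corep_equiv_def)
  obtain f g where "corep_iso Y V W f g" using right_corep_equiv_imp_iso[OF Y e] by blast
  note iso = corep_isoD[OF this]
  note f = iso(1) and g = iso(2) and gf = iso(3) and fg = iso(4) and cf = iso(5) and cg = iso(6)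
  let ?V = "ind_right X Y p V" and ?W = "ind_right X Y p W"
  let ?f = "tmap V X W X f id" and ?g = "tmap W X V X g id"
  note V' = right_corep_vec_space[OF V] and W' = right_corep_vec_space[OF W]
  note X' = cohom_vec_space(1)[OF p] and i = lmap_id[OF cohom_vec_space(1)[OF p]] and c = cohom_id[OF X]
  note subV = subsp_ind_right[OF p V] and subW = subsp_ind_right[OF p W]
  have f': "lmap ?V ?W ?f"
    by (rule lmap_corestrict[OF subW lmap_restrict[OF subV lmap_tmap[OF f i]] ind_right_map[OF p V W f cf]])
  have g': "lmap ?W ?V ?g"
    by (rule lmap_corestrict[OF subV lmap_restrict[OF subW lmap_tmap[OF g i]] ind_right_map[OF p W V g cg]])
  show ?thesis
  proof (rule right_corep_equivI[OF X right_corep_ind_right[OF p V] f' g'])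
    show "?g (?f F) = F" if "F \<in> vecs ?V" for F
    proof -
      note F = subsp_in[OF subV that]
      have "?g (?f F) = tmap V X V X (g \<circ> f) id F" using tmap_comp[OF f i g i F] by simp
      also have "\<dots> = tmap V X V X id id F"
        by (rule tmap_cong[OF lmap_id[OF V'] i F]) (simp_all add: gf)
      finally show ?thesis by (simp add: tmap_id[OF V' X' F])
    qed
    show "?f (?g F) = F" if "F \<in> vecs ?W" for F
    proof -
      note F = subsp_in[OF subW that]
      have "?f (?g F) = tmap W X W X (f \<circ> g) id F" using tmap_comp[OF g i f i F] by simp
      also have "\<dots> = tmap W X W X id id F"
        by (rule tmap_cong[OF lmap_id[OF W'] i F]) (simp_all add: fg)
      finally show ?thesis by (simp add: tmap_id[OF W' X' F])
    qed
    fix F assume F: "F \<in> vecs ?V"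
    note d = coact_ind_right_in[OF p V F]
    have "tmap ?V X ?W X ?f id (coact ?V F) = tmap ?V X (W \<otimes> X) X ?f id (coact ?V F)"
      by (rule tmap_subsp_target[OF subW subsp_refl[OF X'] f' i d])
    also have "\<dots> = tmap (V \<otimes> X) X (W \<otimes> X) X ?f id (stretch V X X id F)"
      using tmap_subsp_source[OF subV subsp_refl[OF X'] lmap_tmap[OF f i] i d]
      by (simp add: coact_ind_right[OF p V F])
    also have "\<dots> = coact ?W (?f F)"
      using stretch_natural[OF f c subsp_in[OF subV F]]
      by (simp add: coact_ind_right[OF p W lmap_in[OF f' F]])
    finally show "coact ?W (?f F) = tmap ?V X ?W X ?f id (coact ?V F)" by simp
  qed
qed

section \<open>Left corepresentations as right corepresentations of the co-opposite coalgebra\<close>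

text \<open>
  The exchange of tensor factors. As tensors are functionals on bilinear forms, it is transposition of
  the form, and it is an involution on the whole type.
\<close>

definition flip :: "('v, 'w, 'k) tensor \<Rightarrow> ('w, 'v, 'k) tensor" where
  "flip t = (\<lambda>b. t (\<lambda>v w. b w v))"

lemma flip_flip [simp]: "flip (flip t) = t"
  by (simp add: flip_def)

lemma flip_inject: "flip s = flip t \<longleftrightarrow> s = t"
  by (metis flip_flip)

lemma flip_tens: "flip (tens V W v w) = tens W V w v"
  by (auto simp: flip_def tens_def bilinear_form_def fun_eq_iff)

lemma lmap_flip:
  fixes V :: "('k::field, 'v::ab_group_add, 'y) vspace_scheme"
    and W :: "('k, 'w::ab_group_add, 'z) vspace_scheme"
  shows "lmap (V \<otimes> W) (W \<otimes> V) flip"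
proof -
  interpret t: vector_space "tscl :: 'k \<Rightarrow> ('v, 'w, 'k) tensor \<Rightarrow> _"
    by (rule tscl_vector_space)
  interpret u: vector_space "tscl :: 'k \<Rightarrow> ('w, 'v, 'k) tensor \<Rightarrow> _"
    by (rule tscl_vector_space)
  let ?S = "{tens V W v w | v w. v \<in> vecs V \<and> w \<in> vecs W}"
  let ?T = "{tens W V w v | w v. w \<in> vecs W \<and> v \<in> vecs V}"
  have add: "flip (s + t) = flip s + flip t" and sc: "flip (tscl c t) = tscl c (flip t)"
    for s t :: "('v, 'w, 'k) tensor" and c
    by (simp_all add: flip_def tscl_def fun_eq_iff)
  have zero: "flip (0 :: ('v, 'w, 'k) tensor) = 0"
    by (simp add: flip_def fun_eq_iff)
  have "t.subspace {t. flip t \<in> u.span ?T}"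
    by (rule t.subspaceI) (simp_all add: add sc zero u.span_zero u.span_add u.span_scale)
  then have "t.span ?S \<subseteq> {t. flip t \<in> u.span ?T}"
    by (rule t.span_minimal[rotated])
      (force simp: flip_tens intro!: u.span_base)
  then show ?thesis
    unfolding lmap_def lin_def
    by (auto simp: vec_space_tensor) (auto simp: tensor_space_def add sc)
qed

lemma flip_tmap:
  assumes f: "lmap V V' f" and g: "lmap W W' g" and t: "t \<in> vecs (V \<otimes> W)"
  shows "flip (tmap V W V' W' f g t) = tmap W V W' V' g f (flip t)"
proof -
  have "(flip \<circ> tmap V W V' W' f g) t = (tmap W V W' V' g f \<circ> flip) t"
    by (rule tensor_eqI[OF lmap_comp[OF lmap_flip lmap_tmap[OF f g]]
          lmap_comp[OF lmap_tmap[OF g f] lmap_flip] t])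
      (simp add: flip_tens tmap_tens[OF f g] tmap_tens[OF g f])
  then show ?thesis by simp
qed

lemma
  assumes V: "vec_space V" and C: "coalgebra C"
  shows cancel_r_flip: "t \<in> vecs (C \<otimes> V) \<Longrightarrow> cancel_r V C (flip t) = cancel_l C V t"
    and cancel_l_flip: "s \<in> vecs (V \<otimes> C) \<Longrightarrow> cancel_l C V (flip s) = cancel_r V C s"
proof -
  have *: "cancel_r V C (flip t) = cancel_l C V t" if t: "t \<in> vecs (C \<otimes> V)" for t
  proof -
    have "(cancel_r V C \<circ> flip) t = cancel_l C V t"
      by (rule tensor_eqI[OF lmap_comp[OF lmap_cancel_r[OF V C] lmap_flip] lmap_cancel_l[OF V C] t])
        (simp add: flip_tens cancel_r_tens[OF V C] cancel_l_tens[OF V C])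
    then show ?thesis by simp
  qed
  then show "t \<in> vecs (C \<otimes> V) \<Longrightarrow> cancel_r V C (flip t) = cancel_l C V t" .
  show "cancel_l C V (flip s) = cancel_r V C s" if "s \<in> vecs (V \<otimes> C)"
    using *[OF lmap_in[OF lmap_flip that]] by simp
qed

lemma flip_assoc_r:
  assumes U: "vec_space U" and V: "vec_space V" and W: "vec_space W"
    and t: "t \<in> vecs ((U \<otimes> V) \<otimes> W)"
  shows "flip (assoc_r U V W t) = tmap (W \<otimes> V) U (V \<otimes> W) U flip id
    (assoc_l W V U (flip (tmap (U \<otimes> V) W (V \<otimes> U) W flip id t)))"
proof -
  note a = lmap_assoc_l[OF W V U] and b = lmap_assoc_r[OF U V W]
  note f = lmap_tmap[OF lmap_flip lmap_id[OF U]] and g = lmap_tmap[OF lmap_flip lmap_id[OF W]]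
  have "(flip \<circ> assoc_r U V W) t = (tmap (W \<otimes> V) U (V \<otimes> W) U flip id \<circ> (assoc_l W V U \<circ>
      (flip \<circ> tmap (U \<otimes> V) W (V \<otimes> U) W flip id))) t"
    by (rule tensor3_left_eqI[OF lmap_comp[OF lmap_flip b]
          lmap_comp[OF f lmap_comp[OF a lmap_comp[OF lmap_flip g]]] t W])
      (simp add: flip_tens assoc_r_tens[OF U V W] assoc_l_tens[OF W V U] tens_in U V W
        tmap_tens[OF lmap_flip lmap_id])
  then show ?thesis by simp
qed

text \<open>
  The two ways of reversing \<open>u \<otimes> (v \<otimes> w)\<close> to \<open>(w \<otimes> v) \<otimes> u\<close>; the next lemma records that such a reversal
  is injective.
\<close>

lemma assoc_l_flip:
  assumes U: "vec_space U" and V: "vec_space V" and W: "vec_space W"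
    and t: "t \<in> vecs (U \<otimes> (V \<otimes> W))"
  shows "assoc_l W V U (flip (tmap (U \<otimes> V) W (V \<otimes> U) W flip id (assoc_l U V W t))) =
    flip (tmap U (V \<otimes> W) U (W \<otimes> V) id flip t)"
proof -
  note a = lmap_assoc_l[OF W V U] and b = lmap_assoc_l[OF U V W]
  note f = lmap_tmap[OF lmap_id[OF U] lmap_flip] and g = lmap_tmap[OF lmap_flip lmap_id[OF W]]
  have "(assoc_l W V U \<circ> (flip \<circ> (tmap (U \<otimes> V) W (V \<otimes> U) W flip id \<circ> assoc_l U V W))) t =
      (flip \<circ> tmap U (V \<otimes> W) U (W \<otimes> V) id flip) t"
    by (rule tensor3_eqI[OF lmap_comp[OF a lmap_comp[OF lmap_flip lmap_comp[OF g b]]]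
          lmap_comp[OF lmap_flip f] t U])
      (simp add: flip_tens assoc_l_tens U V W tens_in tmap_tens[OF lmap_flip lmap_id]
        tmap_tens[OF lmap_id lmap_flip])
  then show ?thesis by simp
qed

lemma assoc_l_flip_inject:
  assumes U: "vec_space U" and V: "vec_space V" and W: "vec_space W"
    and s: "s \<in> vecs ((U \<otimes> V) \<otimes> W)" and t: "t \<in> vecs ((U \<otimes> V) \<otimes> W)"
    and eq: "assoc_l W V U (flip (tmap (U \<otimes> V) W (V \<otimes> U) W flip id s)) =
      assoc_l W V U (flip (tmap (U \<otimes> V) W (V \<otimes> U) W flip id t))"
  shows "s = t"
proof -
  let ?f = "tmap (U \<otimes> V) W (V \<otimes> U) W flip id" and ?g = "tmap (V \<otimes> U) W (U \<otimes> V) W flip id"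
  note f = lmap_tmap[OF lmap_flip lmap_id[OF W]]
  have inv: "?g (?f t) = t" if t: "t \<in> vecs ((U \<otimes> V) \<otimes> W)" for t
  proof -
    have "?g (?f t) = tmap (U \<otimes> V) W (U \<otimes> V) W (flip \<circ> flip) (id \<circ> id) t"
      by (rule tmap_comp[OF lmap_flip lmap_id[OF W] lmap_flip lmap_id[OF W] t])
    also have "\<dots> = tmap (U \<otimes> V) W (U \<otimes> V) W id id t"
      by (rule tmap_cong[OF lmap_id[OF vec_space_tensor] lmap_id[OF W] t]) simp_all
    finally show ?thesis by (simp add: tmap_id[OF vec_space_tensor W t])
  qed
  have "flip (?f s) = flip (?f t)"
    using arg_cong[OF eq, of "assoc_r W V U"] lmap_in[OF lmap_flip lmap_in[OF f s]]
      lmap_in[OF lmap_flip lmap_in[OF f t]] by (simp add: assoc_r_assoc_l[OF W V U])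
  then have "?f s = ?f t" by (simp add: flip_inject)
  then show ?thesis using inv[OF s] inv[OF t] by metis
qed

text \<open>
  A condition of the shape \<open>(\<alpha> \<otimes> id) t = (id \<otimes> \<beta>) t\<close> in a triple tensor product is equivalent to its
  mirror image. With suitable \<open>\<alpha>\<close> and \<open>\<beta>\<close> it covers coassociativity of a coproduct, coassociativity
  of a coaction and the induction condition.
\<close>

lemma flip_coassoc:
  assumes Y: "vec_space Y" and a: "lmap U (U \<otimes> Y) \<alpha>" and b: "lmap W (Y \<otimes> W) \<beta>"
    and t: "t \<in> vecs (U \<otimes> W)"
  shows "assoc_l W Y U (tmap W U W (Y \<otimes> U) id (flip \<circ> \<alpha>) (flip t)) =
      tmap W U (W \<otimes> Y) U (flip \<circ> \<beta>) id (flip t) \<longleftrightarrow>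
    tmap U W (U \<otimes> Y) W \<alpha> id t = assoc_l U Y W (tmap U W U (Y \<otimes> W) id \<beta> t)"
proof -
  note U = lmap_vec_space(1)[OF a] and W = lmap_vec_space(1)[OF b]
  note i = lmap_id[OF U] lmap_id[OF W]
  let ?x = "tmap U W (U \<otimes> Y) W \<alpha> id t" and ?y = "tmap U W U (Y \<otimes> W) id \<beta> t"
  let ?\<theta> = "\<lambda>t. assoc_l W Y U (flip (tmap (U \<otimes> Y) W (Y \<otimes> U) W flip id t))"
  note x = tmap_in[OF a i(2) t] and y = tmap_in[OF i(1) b t]
  have "tmap W U W (Y \<otimes> U) id (flip \<circ> \<alpha>) (flip t) = flip (tmap (U \<otimes> Y) W (Y \<otimes> U) W flip id ?x)"
    using flip_tmap[OF lmap_comp[OF lmap_flip a] i(2) t]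
      tmap_comp[OF a i(2) lmap_flip i(2) t] by simp
  moreover have "tmap W U (W \<otimes> Y) U (flip \<circ> \<beta>) id (flip t) = ?\<theta> (assoc_l U Y W ?y)"
    using flip_tmap[OF i(1) lmap_comp[OF lmap_flip b] t] tmap_comp[OF i(1) b i(1) lmap_flip t]
    by (simp add: assoc_l_flip[OF U Y W y])
  ultimately show ?thesis
    using assoc_l_flip_inject[OF U Y W x lmap_in[OF lmap_assoc_l[OF U Y W] y]] by auto
qed

definition cop :: "('k::field, 'c::ab_group_add, 'z) coalg_scheme \<Rightarrow> ('k, 'c, 'z) coalg_scheme" where
  "cop C = C\<lparr>comult := flip \<circ> comult C\<rparr>"

definition mirror :: "('k::field, 'v::ab_group_add, 'c) lcorep \<Rightarrow> ('k, 'v, 'c) rcorep" where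
  "mirror V = \<lparr>vecs = vecs V, scl = scl V, coact = flip \<circ> coact V\<rparr>"

lemma cop_simps [simp]:
  "vecs (cop C) = vecs C" "scl (cop C) = scl C" "counit (cop C) = counit C"
  "comult (cop C) = flip \<circ> comult C"
  by (simp_all add: cop_def)

lemma mirror_simps [simp]:
  "vecs (mirror V) = vecs V" "scl (mirror V) = scl V" "coact (mirror V) = flip \<circ> coact V"
  by (simp_all add: mirror_def)

text \<open>
  Tensor products and linear maps depend only on the carrier and the scalar multiplication, so
  replacing a coproduct or a coaction does not affect them.
\<close>

lemma same_space:
  assumes v: "vecs V = vecs V'" and s: "scl V = scl V'"
  shows "vec_space V = vec_space V'"
    and "lin V W = lin V' W" "lin W V = lin W V'" "lmap V W = lmap V' W" "lmap W V = lmap W V'"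
    and "tens V W = tens V' W" "tens W V = tens W V'" "V \<otimes> W = V' \<otimes> W" "W \<otimes> V = W \<otimes> V'"
  unfolding vec_space_def lin_def[abs_def] lmap_def[abs_def] tens_def[abs_def] bilinear_form_def
    tensor_space_def v s by simp_all

lemma same_space_maps:
  assumes v: "vecs V = vecs V'" and s: "scl V = scl V'"
  shows "tlift V A B = tlift V' A B" "tlift A V B = tlift A V' B" "tlift A B V = tlift A B V'"
    and "tmap V A B C = tmap V' A B C" "tmap A V B C = tmap A V' B C"
    and "tmap A B V C = tmap A B V' C" "tmap A B C V = tmap A B C V'"
    and "assoc_l V A B = assoc_l V' A B" "assoc_l A V B = assoc_l A V' B"
    and "assoc_l A B V = assoc_l A B V'"
  unfolding tmap_def[abs_def] assoc_l_def[abs_def] tlift_def[abs_def] v same_space[OF v s] by simp_all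

lemmas cop_space [simp] = same_space[OF cop_simps(1,2)] same_space_maps[OF cop_simps(1,2)]
lemmas mirror_space [simp] = same_space[OF mirror_simps(1,2)] same_space_maps[OF mirror_simps(1,2)]

lemma coalgebra_cop:
  assumes C: "coalgebra C"
  shows "coalgebra (cop C)"
proof -
  note C' = coalgebra_vec_space[OF C] and d = lmap_comult[OF C]
  have fd: "lmap C (C \<otimes> C) (flip \<circ> comult C)" by (rule lmap_comp[OF lmap_flip d])
  have "assoc_l C C C (tmap C C C (C \<otimes> C) id (flip \<circ> comult C) (flip (comult C c))) =
      tmap C C (C \<otimes> C) C (flip \<circ> comult C) id (flip (comult C c))" if "c \<in> vecs C" for c
    using flip_coassoc[OF C' d d lmap_in[OF d that]] coassoc[OF C that] by simp
  moreover have "cancel_l C C (flip (comult C c)) = c" "cancel_r C C (flip (comult C c)) = c"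
    if "c \<in> vecs C" for c
    using cancel_l_flip[OF C' C] cancel_r_flip[OF C' C] lmap_in[OF d that] counit_l[OF C that]
      counit_r[OF C that] by simp_all
  ultimately show ?thesis
    using C' fd lin_counit[OF C]
    unfolding coalgebra_def cancel_l_def cancel_r_def lmap_def by simp
qed

lemma cohom_cop:
  assumes p: "cohom X Y p"
  shows "cohom (cop X) (cop Y) p"
proof -
  note X = cohom_coalgebra(1)[OF p] and pl = cohom_lmap[OF p]
  have "flip (comult Y (p x)) = tmap X X Y Y p p (flip (comult X x))" if "x \<in> vecs X" for x
    using flip_tmap[OF pl pl lmap_in[OF lmap_comult[OF X] that]] by (simp add: cohom_comult[OF p that])
  then show ?thesis
    using coalgebra_cop[OF X] coalgebra_cop[OF cohom_coalgebra(2)[OF p]] pl cohom_counit[OF p]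
    by (simp add: cohom_def coalgebra_hom_def lmap_def)
qed

lemma left_corep_iff_mirror:
  assumes C: "coalgebra C"
  shows "left_corep C V \<longleftrightarrow> right_corep (cop C) (mirror V)"
proof -
  note C' = coalgebra_vec_space[OF C]
  have lin_flip: "lin V (V \<otimes> C) (flip \<circ> coact V) \<longleftrightarrow> lin V (C \<otimes> V) (coact V)" if V: "vec_space V"
  proof
    assume "lin V (V \<otimes> C) (flip \<circ> coact V)"
    then have "lmap V (V \<otimes> C) (flip \<circ> coact V)" using V by (simp add: lmap_def vec_space_tensor)
    from lmap_comp[OF lmap_flip this] show "lin V (C \<otimes> V) (coact V)" by (simp add: lmap_def o_def)
  next
    assume "lin V (C \<otimes> V) (coact V)"
    then have "lmap V (C \<otimes> V) (coact V)" using V by (simp add: lmap_def vec_space_tensor)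
    from lmap_comp[OF lmap_flip this] show "lin V (V \<otimes> C) (flip \<circ> coact V)" by (simp add: lmap_def)
  qed
  have "tmap V C (V \<otimes> C) C (flip \<circ> coact V) id (flip (coact V v)) =
        assoc_l V C C (tmap V C V (C \<otimes> C) id (flip \<circ> comult C) (flip (coact V v))) \<longleftrightarrow>
      tmap C V (C \<otimes> C) V (comult C) id (coact V v) =
        assoc_l C C V (tmap C V C (C \<otimes> V) id (coact V) (coact V v))"
    and "cancel_r V C (flip (coact V v)) = cancel_l C V (coact V v)"
    if "vec_space V" "lin V (C \<otimes> V) (coact V)" "v \<in> vecs V" for v
  proof -
    have l: "lmap V (C \<otimes> V) (coact V)" using that by (simp add: lmap_def vec_space_tensor)
    show "tmap V C (V \<otimes> C) C (flip \<circ> coact V) id (flip (coact V v)) =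
        assoc_l V C C (tmap V C V (C \<otimes> C) id (flip \<circ> comult C) (flip (coact V v))) \<longleftrightarrow>
      tmap C V (C \<otimes> C) V (comult C) id (coact V v) =
        assoc_l C C V (tmap C V C (C \<otimes> V) id (coact V) (coact V v))"
      using flip_coassoc[OF C' lmap_comult[OF C] l lmap_in[OF l that(3)]] by (simp add: eq_commute)
    show "cancel_r V C (flip (coact V v)) = cancel_l C V (coact V v)"
      by (rule cancel_r_flip[OF that(1) C lmap_in[OF l that(3)]])
  qed
  then show ?thesis
    unfolding left_corep_def right_corep_def cancel_r_def cancel_l_def
    using lin_flip by (simp cong: conj_cong)
qed

lemma left_corep_equivI:
  assumes C: "coalgebra C" and e: "right_corep_equiv (cop C) (mirror V) (mirror W)"
  shows "left_corep_equiv C V W"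
proof -
  have V: "left_corep C V" and W: "left_corep C W"
    using e by (auto simp: right_corep_equiv_def left_corep_iff_mirror[OF C])
  have V': "lmap V (C \<otimes> V) (coact V)"
    using V by (simp add: left_corep_def lmap_def vec_space_tensor)
  obtain f where f: "lin V W f" and b: "bij_betw f (vecs V) (vecs W)"
    and co: "\<And>v. v \<in> vecs V \<Longrightarrow> flip (coact W (f v)) = tmap V C W C f id (flip (coact V v))"
    using e by (auto simp: right_corep_equiv_def)
  have f': "lmap V W f"
    using f V W by (simp add: left_corep_def lmap_def)
  have "coact W (f v) = tmap C V C W id f (coact V v)" if v: "v \<in> vecs V" for v
    using co[OF v] flip_tmap[OF lmap_id[OF coalgebra_vec_space[OF C]] f' lmap_in[OF V' v]]
    by (metis flip_inject)
  then show ?thesis using V W f b by (auto simp: left_corep_equiv_def)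
qed

text \<open>
  The flip from \<open>V \<otimes> X\<close> to \<open>X \<otimes> V\<close> matches the two induced spaces by \<open>flip_coassoc\<close>. The two coactions
  end up in differently bracketed triple tensor products, which \<open>flip_assoc_r\<close> compares.
\<close>

lemma mirror_ind_left:
  assumes p: "cohom X Y p" and V: "left_corep Y V"
  shows "right_corep_equiv (cop X) (ind_right (cop X) (cop Y) p (mirror V)) (mirror (ind_left X Y p V))"
    (is "right_corep_equiv _ ?R ?L")
proof -
  note X = cohom_coalgebra(1)[OF p] and Y = cohom_coalgebra(2)[OF p]
  note X' = cohom_vec_space(1)[OF p] and Y' = cohom_vec_space(2)[OF p] and i = lmap_id[OF X']
  note pc = cohom_cop[OF p]
  have mV: "right_corep (cop Y) (mirror V)" using V by (simp add: left_corep_iff_mirror[OF Y])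
  have V': "vec_space V" and rho: "lmap V (Y \<otimes> V) (coact V)"
    using V by (auto simp: left_corep_def lmap_def vec_space_tensor)
  note iV = lmap_id[OF V'] and d = lmap_comult[OF X]
  have R: "lmap X (X \<otimes> Y) (R_coact X Y p)"
    using lmap_comp[OF lmap_tmap[OF i cohom_lmap[OF p]] d] by (simp add: R_coact_def[abs_def] o_def)
  have L: "L_coact (cop X) (cop Y) p x = (flip \<circ> R_coact X Y p) x" if "x \<in> vecs X" for x
    using flip_tmap[OF i cohom_lmap[OF p] lmap_in[OF d that]] by (simp add: L_coact_def R_coact_def)
  have vR: "flip F \<in> vecs ?R \<longleftrightarrow> F \<in> vecs ?L" if F: "F \<in> vecs (X \<otimes> V)" for F
  proof -
    note F' = lmap_in[OF lmap_flip F]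
    have "tmap V X V (Y \<otimes> X) id (L_coact (cop X) (cop Y) p) (flip F) =
        tmap V X V (Y \<otimes> X) id (flip \<circ> R_coact X Y p) (flip F)"
      by (rule tmap_cong[OF iV lmap_comp[OF lmap_flip R] F' _ L]) simp_all
    then show ?thesis
      using flip_coassoc[OF Y' R rho F] F F' by (simp add: ind_right_def ind_left_def)
  qed
  have RV: "vecs ?R \<subseteq> vecs (V \<otimes> X)" and LV: "vecs ?L \<subseteq> vecs (X \<otimes> V)"
    by (auto simp: ind_right_def ind_left_def)
  have sL: "subsp ?L (X \<otimes> V)"
    by (rule equalizer_subsp[OF lmap_tmap[OF R iV]
          lmap_comp[OF lmap_assoc_l[OF X' Y' V'] lmap_tmap[OF i rho]]])
      (simp_all add: ind_left_def)
  have sR: "subsp ?R (V \<otimes> X)"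
    using subsp_ind_right[OF pc mV] by simp
  have f: "lmap ?R ?L flip"
  proof (rule lmap_corestrict[OF sL lmap_restrict[OF sR lmap_flip]])
    fix F assume F: "F \<in> vecs ?R"
    then have "flip F \<in> vecs (X \<otimes> V)" using RV lmap_in[OF lmap_flip] by blast
    from vR[OF this] F show "flip F \<in> vecs ?L" by simp
  qed
  have g: "lmap ?L ?R flip"
    by (rule lmap_corestrict[OF sR lmap_restrict[OF sL lmap_flip]]) (use vR LV in blast)
  show ?thesis
  proof (rule right_corep_equivI[OF cohom_coalgebra(1)[OF pc] right_corep_ind_right[OF pc mV] f g])
    fix F assume F: "F \<in> vecs ?R"
    have F': "flip F \<in> vecs (X \<otimes> V)" using F RV lmap_in[OF lmap_flip] by blast
    note di = tmap_in[OF d iV F']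
    have c: "coact ?R F \<in> vecs (?R \<otimes> X)"
      using coact_ind_right_in[OF pc mV F] by simp
    have "coact ?R F = assoc_l V X X (tmap V X V (X \<otimes> X) id (flip \<circ> comult X) F)"
      by (simp add: ind_right_def)
    also have "tmap V X V (X \<otimes> X) id (flip \<circ> comult X) F =
        flip (tmap (X \<otimes> X) V (X \<otimes> X) V flip id (tmap X V (X \<otimes> X) V (comult X) id (flip F)))"
      using flip_tmap[OF lmap_comp[OF lmap_flip d] iV F'] tmap_comp[OF d iV lmap_flip iV F'] by simp
    finally have coR: "coact ?R F = assoc_l V X X (flip (tmap (X \<otimes> X) V (X \<otimes> X) V flip id
        (tmap X V (X \<otimes> X) V (comult X) id (flip F))))" .
    have "tmap ?R X ?L X flip id (coact ?R F) = tmap ?R X (X \<otimes> V) X flip id (coact ?R F)"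
      by (rule tmap_subsp_target[OF sL subsp_refl[OF X'] f i c])
    also have "\<dots> = tmap (V \<otimes> X) X (X \<otimes> V) X flip id (coact ?R F)"
      by (rule tmap_subsp_source[OF sR subsp_refl[OF X'] lmap_flip i c])
    also have "\<dots> = flip (assoc_r X X V (tmap X V (X \<otimes> X) V (comult X) id (flip F)))"
      unfolding coR by (rule flip_assoc_r[OF X' X' V' di, symmetric])
    finally show "coact ?L (flip F) = tmap ?R (cop X) ?L (cop X) flip id (coact ?R F)"
      by (simp add: ind_left_def)
  qed simp_all
qed

text \<open>
  The equivalence is the composite, for the co-opposite coalgebras and with \<open>V'\<close> the mirror image of
  \<open>V\<close>, of mirror images and right inductions
  \<open>mirror (ind G H V) \<equiv> ind G H V' \<equiv> ind G K (ind K H V') \<equiv> ind G K (mirror (ind K H V)) \<equiv>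
  mirror (ind G K (ind K H V))\<close>.
\<close>

theorem ind_left_in_stages:
  assumes p: "cohom G K p" and q: "cohom K H q" and V: "left_corep H V"
  shows "left_corep_equiv G (ind_left G H (q \<circ> p) V) (ind_left G K p (ind_left K H q V))"
proof (rule left_corep_equivI[OF cohom_coalgebra(1)[OF p]])
  let ?G = "cop G" and ?K = "cop K" and ?H = "cop H"
  note pc = cohom_cop[OF p] and qc = cohom_cop[OF q]
  note G = cohom_coalgebra(1)[OF pc]
  note sym = right_corep_equiv_sym[OF G] and trans = right_corep_equiv_trans[OF G]
  have mV: "right_corep ?H (mirror V)"
    using V by (simp add: left_corep_iff_mirror[OF cohom_coalgebra(2)[OF q]])
  note m = mirror_ind_left[OF q V]
  have M: "left_corep K (ind_left K H q V)"
    using m by (simp add: left_corep_iff_mirror[OF cohom_coalgebra(1)[OF q]] right_corep_equiv_def)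
  show "right_corep_equiv ?G (mirror (ind_left G H (q \<circ> p) V))
      (mirror (ind_left G K p (ind_left K H q V)))"
    by (rule trans[OF sym[OF mirror_ind_left[OF cohom_comp[OF p q] V]]
          trans[OF ind_right_in_stages[OF pc qc mV]
            trans[OF ind_right_equiv[OF pc m] mirror_ind_left[OF p M]]]])
qed

section \<open>Induction in stages\<close>

lemma truncate_simps:
  "vecs (coalg.truncate C) = vecs C" "scl (coalg.truncate C) = scl C"
  "comult (coalg.truncate C) = comult C" "counit (coalg.truncate C) = counit C"
  by (simp_all add: coalg.truncate_def)

text \<open>
  For a Hopf algebra \<open>K'\<close>, induction refers to its underlying coalgebra.
\<close>

lemma cohom_truncate:
  shows "cohom X (coalg.truncate Y) p \<longleftrightarrow> cohom X Y p"
    and "cohom (coalg.truncate Y) Z q \<longleftrightarrow> cohom Y Z q"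
  unfolding cohom_def coalgebra_hom_def coalgebra_def truncate_simps
    same_space[OF truncate_simps(1,2)] same_space_maps[OF truncate_simps(1,2)]
  by simp_all

theorem proposition3p8:
  fixes G :: "('k::field_char_0, 'g::ab_group_add) hopf"
    and K :: "('k, 'c::ab_group_add) coalg"
    and H :: "('k, 'h::ab_group_add) coalg"
    and \<pi>GK :: "'g \<Rightarrow> 'c" and \<pi>KH :: "'c \<Rightarrow> 'h"
  assumes G: "hopf_algebra G"
    and GKH: "(\<exists>K' :: ('k, 'c) hopf. coalg.truncate K' = K \<and> quantum_subgroup G K' \<pi>GK \<and>
            ((\<exists>act. left_coisotropic K' H act \<pi>KH) \<or> (\<exists>act. right_coisotropic K' H act \<pi>KH))) \<or>
         (\<exists>actK actH. left_coisotropic G K actK \<pi>GK \<and>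
            left_coisotropic_over G K actK H actH \<pi>KH) \<or>
         (\<exists>actK actH. right_coisotropic G K actK \<pi>GK \<and>
            right_coisotropic_over G K actK H actH \<pi>KH)"
  shows "(\<forall>\<rho>R :: ('k, 'v::ab_group_add, 'h) rcorep. right_corep H \<rho>R \<longrightarrow>
            right_corep_equiv G (ind_right G H (\<pi>KH \<circ> \<pi>GK) \<rho>R)
              (ind_right G K \<pi>GK (ind_right K H \<pi>KH \<rho>R))) \<and>
         (\<forall>\<rho>L :: ('k, 'w::ab_group_add, 'h) lcorep. left_corep H \<rho>L \<longrightarrow>
            left_corep_equiv G (ind_left G H (\<pi>KH \<circ> \<pi>GK) \<rho>L)
              (ind_left G K \<pi>GK (ind_left K H \<pi>KH \<rho>L)))"
proof -
  have "cohom G K \<pi>GK \<and> cohom K H \<pi>KH"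
    using GKH
  proof (elim disjE exE conjE)
    fix K' :: "('k, 'c) hopf" and act
    assume K: "coalg.truncate K' = K" and GK: "quantum_subgroup G K' \<pi>GK"
      and "left_coisotropic K' H act \<pi>KH"
    then have "cohom G K' \<pi>GK" "cohom K' H \<pi>KH"
      by (auto simp: quantum_subgroup_def hopf_algebra_def hopf_hom_def cohom_def
          left_coisotropic_def left_coisotropic_over_def)
    then show ?thesis by (simp flip: K add: cohom_truncate)
  next
    fix K' :: "('k, 'c) hopf" and act
    assume K: "coalg.truncate K' = K" and GK: "quantum_subgroup G K' \<pi>GK"
      and "right_coisotropic K' H act \<pi>KH"
    then have "cohom G K' \<pi>GK" "cohom K' H \<pi>KH"
      by (auto simp: quantum_subgroup_def hopf_algebra_def hopf_hom_def cohom_def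
          right_coisotropic_def right_coisotropic_over_def)
    then show ?thesis by (simp flip: K add: cohom_truncate)
  qed (auto simp: hopf_algebra_def cohom_def left_coisotropic_def left_coisotropic_over_def
      right_coisotropic_def right_coisotropic_over_def)
  then show ?thesis
    using ind_right_in_stages[of G K \<pi>GK H \<pi>KH] ind_left_in_stages[of G K \<pi>GK H \<pi>KH] by blast
qed

end
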